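(* Let $M\ge 2$ be an integer, $\epsilon>0$ and $\beta\in(\tfrac12,1)$. Run the AIR policy with the resolving set $\mathcal T^F(M)=\mathcal T^F_L(M)\cup\mathcal T^F_A(M)$, where $\mathcal T^F_L(M)=\{\lceil T^{(1/2+\epsilon)\beta^{M-2}}\rceil,\lceil T/2\rceil\}$ and $\mathcal T^F_A(M)=\{\lceil T-T^{\beta^k}\rceil: k=1,\dots,M-2\}$. Then the regret of the AIR policy is $\mathcal O\big(T^{(1/2+\epsilon)\beta^{M-2}}\big)$.
   Context: Online linear programming setting: there are $m$ resources and $n$ customer types. Type $j\in[n]$ has reward $r_j\ge 0$ and consumption vector $\boldsymbol A_j\in\mathbb R_+^m$ (the $j$-th column of $\boldsymbol A\in\mathbb R_+^{m\times n}$); $\boldsymbol r=(r_1,\dots,r_n)$. There are $T$ periods and initial inventory $T\boldsymbol\rho$, $\boldsymbol\rho\in\mathbb R_+^m$. In each period $t$ one customer arrives whose type $j^t$ is drawn i.i.d. from an unknown probability vector $\boldsymbol p$ with $p_j>0$ for all $j$. After observing $j^t$ the decision maker irrevocably accepts (consuming $\boldsymbol A_{j^t}$, earning $r_{j^t}$) or rejects; total consumption may never exceed $T\boldsymbol\rho$. $V^*(T)$ is the supremum over feasible non-anticipative policies of the expected total reward, $V^\mu(T)$ the expected reward of policy $\mu$, $\mathrm{Reg}^\mu(T)=V^*(T)-V^\mu(T)$. Let $\phi(\boldsymbol b,\boldsymbol d)=\max\{\boldsymbol r^\top\boldsymbol y:\boldsymbol A\boldsymbol y\le\boldsymbol b,\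 \boldsymbol 0\le\boldsymbol y\le\boldsymbol d\}$; $\boldsymbol e_j$ is the $j$-th unit vector. AIR policy with resolving set $\mathcal T$: maintain $\boldsymbol b^t$ ($\boldsymbol b^1=T\boldsymbol\rho$), $\boldsymbol N^t$ (arrival counts of each type in periods $1,\dots,t-1$), $\boldsymbol u^t,\boldsymbol d^t$ with $\boldsymbol u^1=\boldsymbol d^1=\boldsymbol 0$. In period $t$: if $t\in\mathcal T$, set $\hat p^t_j=N^t_j/(t-1)$ ($\hat{\boldsymbol p}^1=\boldsymbol 0$), take an optimal solution $\boldsymbol y^*$ of $\phi(\boldsymbol b^t,(T-t+1)\hat{\boldsymbol p}^t)$, reset $\boldsymbol u^t=\boldsymbol y^*$, $\boldsymbol d^t=(T-t+1)\hat{\boldsymbol p}^t$. Observe $j=j^t$; if $\boldsymbol A_j\le\boldsymbol b^t$, $u^t_j>1$ and $u^t_j\ge d^t_j-u^t_j$, accept, $\boldsymbol b^{t+1}=\boldsymbol b^t-\boldsymbol A_j$, $\boldsymbol u^{t+1}=\boldsymbol u^t-\boldsymbol e_j$; else reject, $\boldsymbol b^{t+1}=\boldsymbol b^t$, $\boldsymbol u^{t+1}=\boldsymbol u^t$. Always $\boldsymbol d^{t+1}=\boldsymbol d^t-\boldsymbol e_j$, $\boldsymbol N^{t+1}=\boldsymbol N^t+\boldsymbol e_j$. $\mathcal O(f(T))$ means bounded by $Cf(T)$ with $C$ independent of $T$ (possibly depending on the instance and on $M,\epsilon,\beta$). *)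

theory Defs
  imports "HOL-Probability.Probability"
begin

text \<open>An instance consists of the consumption matrix \<open>A\<close> (resources \<open>'m\<close>, customer types \<open>'n\<close>), the
  rewards \<open>r\<close>, the inventory per period \<open>\<rho>\<close> and the distribution \<open>p\<close> of customer types. Vectors are
  ordered componentwise.

  A non-anticipative policy maps the history \<open>[j\<^sup>1, \<dots>, j\<^sup>t]\<close>, current customer included, to the
  accept/reject decision of period \<open>t\<close>. List position \<open>k\<close> is period \<open>k + 1\<close>.\<close>

type_synonym 'n policy = "'n list \<Rightarrow> bool"

definition consumption :: "real ^ 'n ^ 'm \<Rightarrow> 'n policy \<Rightarrow> 'n list \<Rightarrow> real ^ 'm" where
  "consumption A \<pi> h = (\<Sum>k<length h. if \<pi> (take (Suc k) h) then column (h ! k) A else 0)"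

definition reward :: "real ^ 'n \<Rightarrow> 'n policy \<Rightarrow> 'n list \<Rightarrow> real" where
  "reward r \<pi> h = (\<Sum>k<length h. if \<pi> (take (Suc k) h) then r $ (h ! k) else 0)"

text \<open>Feasibility is required on all histories: every type has positive probability, so every
  history occurs with positive probability.\<close>

definition feasible_policy ::
    "real ^ 'n ^ 'm \<Rightarrow> real ^ 'm \<Rightarrow> nat \<Rightarrow> 'n policy \<Rightarrow> bool" where
  "feasible_policy A \<rho> T \<pi> \<longleftrightarrow> (\<forall>h. length h \<le> T \<longrightarrow> consumption A \<pi> h \<le> real T *\<^sub>R \<rho>)"

definition policy_value :: "real ^ 'n \<Rightarrow> 'n pmf \<Rightarrow> nat \<Rightarrow> 'n policy \<Rightarrow> real" where
  "policy_value r p T \<pi> = measure_pmf.expectation (replicate_pmf T p) (reward r \<pi>)"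

text \<open>For \<open>\<rho> \<ge> 0\<close> the supremum ranges over a nonempty set of values (rejecting everybody is
  feasible) that is bounded above by \<open>T\<close> times the largest reward.\<close>

definition optimal_value ::
    "real ^ 'n ^ 'm \<Rightarrow> real ^ 'n \<Rightarrow> real ^ 'm \<Rightarrow> 'n pmf \<Rightarrow> nat \<Rightarrow> real" where
  "optimal_value A r \<rho> p T = (SUP \<pi>\<in>{\<pi>. feasible_policy A \<rho> T \<pi>}. policy_value r p T \<pi>)"

definition regret ::
    "real ^ 'n ^ 'm \<Rightarrow> real ^ 'n \<Rightarrow> real ^ 'm \<Rightarrow> 'n pmf \<Rightarrow> nat \<Rightarrow> 'n policy \<Rightarrow> real" where
  "regret A r \<rho> p T \<pi> = optimal_value A r \<rho> p T - policy_value r p T \<pi>"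

text \<open>\<open>y\<close> is an optimal solution of the linear program defining \<open>\<phi>(b, d)\<close>.\<close>

definition lp_optimal ::
    "real ^ 'n ^ 'm \<Rightarrow> real ^ 'n \<Rightarrow> real ^ 'm \<Rightarrow> real ^ 'n \<Rightarrow> real ^ 'n \<Rightarrow> bool" where
  "lp_optimal A r b d = is_arg_max (\<lambda>y. r \<bullet> y) (\<lambda>y. A *v y \<le> b \<and> 0 \<le> y \<and> y \<le> d)"

text \<open>The choice among several optimal solutions may depend on the arrivals observed so far (first
  argument of \<open>sel\<close>) as well as on the data \<open>b\<close>, \<open>d\<close> of the linear program. For \<open>b, d \<ge> 0\<close> an
  optimal solution always exists.\<close>

definition lp_selector ::
    "real ^ 'n ^ 'm \<Rightarrow> real ^ 'n \<Rightarrow> ('n list \<Rightarrow> real ^ 'm \<Rightarrow> real ^ 'n \<Rightarrow> real ^ 'n) \<Rightarrow> bool" where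
  "lp_selector A r sel \<longleftrightarrow> (\<forall>h b d. 0 \<le> b \<longrightarrow> 0 \<le> d \<longrightarrow> lp_optimal A r b d (sel h b d))"

text \<open>The components are \<open>b\<^sup>t\<close>, \<open>N\<^sup>t\<close>, \<open>u\<^sup>t\<close> and \<open>d\<^sup>t\<close>.\<close>

record ('m, 'n) air_state =
  inventory :: "real ^ 'm"
  arrivals :: "real ^ 'n"
  plan :: "real ^ 'n"
  demand :: "real ^ 'n"

text \<open>The resolving step at the start of period \<open>t\<close>, where \<open>h\<close> lists the arrivals of periods
  \<open>1, \<dots>, t - 1\<close>. The convention that the estimate in period 1 is 0 comes from \<open>x / 0 = 0\<close>.\<close>

definition air_resolve ::
    "('n list \<Rightarrow> real ^ 'm \<Rightarrow> real ^ 'n \<Rightarrow> real ^ 'n) \<Rightarrow> nat \<Rightarrow> nat set \<Rightarrow> 'n list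
      \<Rightarrow> ('m, 'n) air_state \<Rightarrow> ('m, 'n) air_state" where
  "air_resolve sel T \<T> h s =
    (let t = Suc (length h);
         phat = (\<chi> j. arrivals s $ j / (real t - 1));
         d = (real T - real t + 1) *\<^sub>R phat
     in if t \<in> \<T> then s\<lparr>plan := sel h (inventory s) d, demand := d\<rparr> else s)"

definition air_accepts :: "real ^ 'n ^ 'm \<Rightarrow> ('m, 'n) air_state \<Rightarrow> 'n \<Rightarrow> bool" where
  "air_accepts A s j \<longleftrightarrow>
     column j A \<le> inventory s \<and> plan s $ j > 1 \<and> plan s $ j \<ge> demand s $ j - plan s $ j"

definition air_update :: "real ^ 'n ^ 'm \<Rightarrow> ('m, 'n) air_state \<Rightarrow> 'n \<Rightarrow> ('m, 'n) air_state" where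
  "air_update A s j =
    \<lparr>inventory = (if air_accepts A s j then inventory s - column j A else inventory s),
     arrivals = arrivals s + axis j 1,
     plan = (if air_accepts A s j then plan s - axis j 1 else plan s),
     demand = demand s - axis j 1\<rparr>"

text \<open>The state at the start of period \<open>k + 1\<close>, before resolving; it depends only on the first \<open>k\<close>
  entries of \<open>h\<close>.\<close>

primrec air_state_at ::
    "real ^ 'n ^ 'm \<Rightarrow> real ^ 'm \<Rightarrow> ('n list \<Rightarrow> real ^ 'm \<Rightarrow> real ^ 'n \<Rightarrow> real ^ 'n) \<Rightarrow> nat
      \<Rightarrow> nat set \<Rightarrow> 'n list \<Rightarrow> nat \<Rightarrow> ('m, 'n) air_state" where
  "air_state_at A \<rho> sel T \<T> h 0 =
     \<lparr>inventory = real T *\<^sub>R \<rho>, arrivals = 0, plan = 0, demand = 0\<rparr>"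
| "air_state_at A \<rho> sel T \<T> h (Suc k) =
     air_update A (air_resolve sel T \<T> (take k h) (air_state_at A \<rho> sel T \<T> h k)) (h ! k)"

definition air_policy ::
    "real ^ 'n ^ 'm \<Rightarrow> real ^ 'm \<Rightarrow> ('n list \<Rightarrow> real ^ 'm \<Rightarrow> real ^ 'n \<Rightarrow> real ^ 'n) \<Rightarrow> nat
      \<Rightarrow> nat set \<Rightarrow> 'n policy" where
  "air_policy A \<rho> sel T \<T> h =
    (let k = length h - 1
     in air_accepts A (air_resolve sel T \<T> (take k h) (air_state_at A \<rho> sel T \<T> h k)) (h ! k))"

definition resolving_set_L :: "real \<Rightarrow> real \<Rightarrow> nat \<Rightarrow> nat \<Rightarrow> nat set" where
  "resolving_set_L \<epsilon> \<beta> M T =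
     {nat \<lceil>real T powr ((1/2 + \<epsilon>) * \<beta> ^ (M - 2))\<rceil>, nat \<lceil>real T / 2\<rceil>}"

definition resolving_set_A :: "real \<Rightarrow> nat \<Rightarrow> nat \<Rightarrow> nat set" where
  "resolving_set_A \<beta> M T = {nat \<lceil>real T - real T powr (\<beta> ^ k)\<rceil> | k. k \<in> {1..M - 2}}"

definition resolving_set :: "real \<Rightarrow> real \<Rightarrow> nat \<Rightarrow> nat \<Rightarrow> nat set" where
  "resolving_set \<epsilon> \<beta> M T = resolving_set_L \<epsilon> \<beta> M T \<union> resolving_set_A \<beta> M T"

end

theory Submission
  imports Defs "HOL-Real_Asymp.Real_Asymp"
begin

text \<open>The hindsight value \<open>\<phi>(b\<^sup>t, D\<^sup>t)\<close>, with \<open>D\<^sup>t\<close> the true arrivals of periods \<open>t, \<dots>, T\<close>, bounds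
  the optimum from above and is compared with the reward period by period. Between two resolving
  periods \<open>(u\<^sup>t, d\<^sup>t)\<close> stays optimal for inventory \<open>b\<^sup>t\<close>, and \<open>d\<^sup>t - D\<^sup>t\<close> keeps the value \<open>E\<close> it had at
  the last resolving period. Optimal solutions depend on the demands in a Lipschitz way (Hoffman's
  error bound), so as long as every component of \<open>D\<^sup>t\<close> dominates \<open>|E|\<close>, accepting whenever at least half
  of the forecast demand is planned loses no hindsight value; any other period loses at most a constant.

  With \<open>\<alpha> = (1/2 + \<epsilon>) \<beta>\<^bsup>M - 2\<^esup>\<close>, disregard the first and the last \<open>T\<^bsup>\<alpha>\<^esup>\<close> periods. For any other \<open>t\<close>,
  Hoeffding's inequality bounds the probability of a loss by \<open>exp (- c \<ell>\<^sup>2 / (L\<^sup>2/s + L))\<close>, where \<open>s\<close> is the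
  sample size of the last forecast, \<open>L\<close> the length of its horizon and \<open>\<ell> = T - t + 1\<close>. For the given
  resolving periods the exponent is at least of order \<open>T\<^bsup>\<delta>\<^esup>\<close> for some \<open>\<delta> > 0\<close>: in the first half because
  \<open>s\<close> is at least of order \<open>T\<^bsup>\<alpha>\<^esup>\<close>, afterwards because \<open>L\<close> is of order \<open>T\<^bsup>\<beta>^k\<^esup>\<close> and \<open>\<ell>\<close> exceeds
  \<open>T\<^bsup>\<beta>^(k+1)\<^esup>\<close>, with \<open>2\<beta> > 1\<close>, or in the last phase \<open>T\<^bsup>\<alpha>\<^esup>\<close>, with \<open>2\<alpha> > \<beta>\<^bsup>M - 2\<^esup>\<close>.\<close>

section \<open>Hoffman's error bound\<close>

text \<open>By compactness: a unit vector of the polar cone of \<open>{z. \<forall>i\<in>J. a i \<bullet> z \<le> 0}\<close> does not lie in this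
  cone, so the right-hand side is positive on the compact set of all such vectors. Applied to the
  active constraints at the closest feasible point, this replaces Farkas' lemma in the proof of
  Hoffman's bound.\<close>

lemma polar_cone_bound:
  fixes a :: "'i \<Rightarrow> 'a::euclidean_space"
  assumes "finite J"
  shows "\<exists>\<kappa>>0. \<forall>v. (\<forall>z. (\<forall>i\<in>J. a i \<bullet> z \<le> 0) \<longrightarrow> v \<bullet> z \<le> 0) \<longrightarrow>
           \<kappa> * norm v \<le> (\<Sum>i\<in>J. max 0 (a i \<bullet> v))"
proof -
  define Z where "Z = {z. \<forall>i\<in>J. a i \<bullet> z \<le> 0}"
  define P where "P = sphere 0 1 \<inter> (\<Inter>z\<in>Z. {v. v \<bullet> z \<le> 0})"
  define f where "f v = (\<Sum>i\<in>J. max 0 (a i \<bullet> v))" for v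
  have "closed (\<Inter>z\<in>Z. {v. v \<bullet> z \<le> 0})"
    by (intro closed_INT ballI closed_Collect_le continuous_intros)
  then have "compact P"
    unfolding P_def by (intro compact_Int_closed compact_sphere)
  have cont: "continuous_on P f"
    unfolding f_def by (intro continuous_intros)
  have pos: "0 < f v" if "v \<in> P" for v
  proof -
    have "\<not> (\<forall>i\<in>J. a i \<bullet> v \<le> 0)"
    proof
      assume "\<forall>i\<in>J. a i \<bullet> v \<le> 0"
      then have "v \<in> Z" by (simp add: Z_def)
      then have "v \<bullet> v \<le> 0" using that by (auto simp: P_def)
      moreover have "norm v = 1" using that by (simp add: P_def)
      ultimately show False by (simp add: dot_square_norm)
    qed
    then obtain i where "i \<in> J" "0 < a i \<bullet> v" by force
    then show ?thesis unfolding f_def by (intro sum_pos2[of J i]) (auto simp: assms)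
  qed
  obtain \<kappa> where \<kappa>: "\<kappa> > 0" "\<And>v. v \<in> P \<Longrightarrow> \<kappa> \<le> f v"
  proof (cases "P = {}")
    case True
    then show ?thesis using that[of 1] by simp
  next
    case False
    then show ?thesis using continuous_attains_inf[OF \<open>compact P\<close> False cont] pos that by metis
  qed
  have "\<kappa> * norm v \<le> f v" if v: "\<forall>z. (\<forall>i\<in>J. a i \<bullet> z \<le> 0) \<longrightarrow> v \<bullet> z \<le> 0" for v
  proof (cases "v = 0")
    case True
    then show ?thesis by (simp add: f_def)
  next
    case False
    then have "v /\<^sub>R norm v \<in> P"
      using v by (auto simp: P_def Z_def intro!: mult_nonneg_nonpos)
    then have "\<kappa> \<le> f (v /\<^sub>R norm v)" by (rule \<kappa>)
    also have "\<dots> = f v / norm v"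
      unfolding f_def sum_divide_distrib
      by (intro sum.cong refl) (auto simp: max_def field_simps False zero_le_divide_iff)
    finally show ?thesis using False by (simp add: field_simps)
  qed
  then show ?thesis using \<kappa>(1) unfolding f_def by blast
qed

text \<open>If \<open>x\<close> is the feasible point closest to \<open>u\<close>, then
  \<open>u - x\<close> lies in the polar of the cone cut out by the constraints active at
  \<open>x\<close>, and \<open>u\<close> exceeds each of these by at most \<open>e\<close>. The
  constant must not depend on the right-hand side.\<close>

lemma hoffman_bound:
  fixes a :: "'i \<Rightarrow> 'a::euclidean_space"
  assumes "finite I"
  shows "\<exists>K\<ge>0. \<forall>\<beta> u e. {x. \<forall>i\<in>I. a i \<bullet> x \<le> \<beta> i} \<noteq> {} \<longrightarrow> 0 \<le> e \<longrightarrow>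
           (\<forall>i\<in>I. a i \<bullet> u \<le> \<beta> i + e) \<longrightarrow>
           (\<exists>x. (\<forall>i\<in>I. a i \<bullet> x \<le> \<beta> i) \<and> norm (u - x) \<le> K * e)"
proof -
  have "\<forall>J\<in>Pow I. \<exists>\<kappa>>0. \<forall>v. (\<forall>z. (\<forall>i\<in>J. a i \<bullet> z \<le> 0) \<longrightarrow> v \<bullet> z \<le> 0) \<longrightarrow>
           \<kappa> * norm v \<le> (\<Sum>i\<in>J. max 0 (a i \<bullet> v))"
    using assms by (auto intro!: polar_cone_bound intro: finite_subset)
  then obtain \<kappa> where \<kappa>: "\<And>J. J \<subseteq> I \<Longrightarrow> \<kappa> J > 0"
    "\<And>J v. \<lbrakk>J \<subseteq> I; \<And>z. (\<And>i. i \<in> J \<Longrightarrow> a i \<bullet> z \<le> 0) \<Longrightarrow> v \<bullet> z \<le> 0\<rbrakk> \<Longrightarrow>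
       \<kappa> J * norm v \<le> (\<Sum>i\<in>J. max 0 (a i \<bullet> v))"
    unfolding bchoice_iff by (metis PowI)
  \<comment> \<open>The active set varies with \<open>\<beta>\<close> and \<open>u\<close>; the
    minimum over all index subsets gives one constant for all of them.\<close>
  define k where "k = Min (\<kappa> ` Pow I)"
  have "k \<in> \<kappa> ` Pow I" unfolding k_def using assms by (intro Min_in) auto
  then have k: "0 < k" "\<And>J. J \<subseteq> I \<Longrightarrow> k \<le> \<kappa> J"
    using assms \<kappa>(1) by (auto simp: k_def intro!: Min_le)
  have "\<exists>x. (\<forall>i\<in>I. a i \<bullet> x \<le> \<beta> i) \<and> norm (u - x) \<le> card I / k * e"
    if ne: "{x. \<forall>i\<in>I. a i \<bullet> x \<le> \<beta> i} \<noteq> {}" and e: "0 \<le> e"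
      and u: "\<forall>i\<in>I. a i \<bullet> u \<le> \<beta> i + e" for \<beta> u e
  proof -
    define S where "S = (\<Inter>i\<in>I. {x. a i \<bullet> x \<le> \<beta> i})"
    have S: "closed S" "convex S" "S \<noteq> {}"
      using ne by (auto simp: S_def convex_halfspace_le
        intro!: closed_INT convex_INT closed_halfspace_le)
    define x where "x = closest_point S u"
    have xS: "x \<in> S" unfolding x_def by (rule closest_point_in_set[OF S(1,3)])
    define J where "J = {i\<in>I. a i \<bullet> x = \<beta> i}"
    have J: "J \<subseteq> I" by (auto simp: J_def)
    \<comment> \<open>A short move from \<open>x\<close> along \<open>z\<close> stays feasible:
      active constraints do not increase, inactive ones keep their slack by continuity. The
      variational inequality of the closest point then gives the sign.\<close>
    have polar: "(u - x) \<bullet> z \<le> 0" if z: "\<And>i. i \<in> J \<Longrightarrow> a i \<bullet> z \<le> 0" for z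
    proof -
      have "\<forall>\<^sub>F t in at_right 0. a i \<bullet> (x + t *\<^sub>R z) \<le> \<beta> i" if "i \<in> I" for i
      proof (cases "i \<in> J")
        case True
        have "a i \<bullet> (x + t *\<^sub>R z) \<le> \<beta> i" if "t > 0" for t
          using True z[OF True] that mult_nonneg_nonpos[of t "a i \<bullet> z"]
          by (simp add: J_def inner_add_right)
        then show ?thesis by (auto simp: eventually_at_filter)
      next
        case False
        then have "a i \<bullet> x < \<beta> i" using that xS by (auto simp: J_def S_def order_less_le)
        moreover have "((\<lambda>t. a i \<bullet> (x + t *\<^sub>R z)) \<longlongrightarrow> a i \<bullet> (x + 0 *\<^sub>R z)) (at_right 0)"
          by (intro tendsto_intros)
        ultimately have "\<forall>\<^sub>F t in at_right 0. a i \<bullet> (x + t *\<^sub>R z) < \<beta> i"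
          by (intro order_tendstoD) auto
        then show ?thesis by eventually_elim simp
      qed
      then have "\<forall>\<^sub>F t in at_right 0. \<forall>i\<in>I. a i \<bullet> (x + t *\<^sub>R z) \<le> \<beta> i"
        by (intro eventually_ball_finite assms) auto
      moreover have "\<forall>\<^sub>F t in at_right (0::real). 0 < t" by (simp add: eventually_at_filter)
      ultimately have "\<forall>\<^sub>F t in at_right (0::real). 0 < t \<and> x + t *\<^sub>R z \<in> S"
        by eventually_elim (auto simp: S_def)
      then obtain t where t: "0 < t" "x + t *\<^sub>R z \<in> S"
        using eventually_happens'[OF trivial_limit_at_right_real] by blast
      have "(u - x) \<bullet> ((x + t *\<^sub>R z) - x) \<le> 0"
        unfolding x_def by (rule closest_point_dot[OF S(2,1)]) (use t in \<open>simp add: x_def\<close>)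
      then show ?thesis using t(1) by (simp add: mult_le_0_iff)
    qed
    have "k * norm (u - x) \<le> \<kappa> J * norm (u - x)"
      using k(2)[OF J] by (intro mult_right_mono) auto
    also have "\<dots> \<le> (\<Sum>i\<in>J. max 0 (a i \<bullet> (u - x)))"
      by (rule \<kappa>(2)[OF J polar])
    also have "\<dots> \<le> (\<Sum>i\<in>J. e)"
      using u e by (intro sum_mono) (auto simp: J_def inner_diff_right)
    also have "\<dots> \<le> card I * e"
      using e J assms by (auto intro!: mult_right_mono card_mono)
    finally have "norm (u - x) \<le> card I / k * e" using k(1) by (simp add: field_simps)
    then show ?thesis using xS by (auto simp: S_def)
  qed
  then show ?thesis using k(1) by (intro exI[of _ "card I / k"]) auto
qed

section \<open>Packing linear programs\<close>

definition lp_feasible :: "real ^ 'n ^ 'm \<Rightarrow> real ^ 'm \<Rightarrow> real ^ 'n \<Rightarrow> (real ^ 'n) set" where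
  "lp_feasible A b d = {y. A *v y \<le> b \<and> 0 \<le> y \<and> y \<le> d}"

definition lp_value :: "real ^ 'n ^ 'm \<Rightarrow> real ^ 'n \<Rightarrow> real ^ 'm \<Rightarrow> real ^ 'n \<Rightarrow> real" where
  "lp_value A r b d = (SUP y\<in>lp_feasible A b d. r \<bullet> y)"

lemma lp_optimal_iff:
  "lp_optimal A r b d u \<longleftrightarrow> u \<in> lp_feasible A b d \<and> (\<forall>y\<in>lp_feasible A b d. r \<bullet> y \<le> r \<bullet> u)"
  by (auto simp: lp_optimal_def is_arg_max_def lp_feasible_def not_less)

lemma lp_value_eq: "lp_optimal A r b d u \<Longrightarrow> lp_value A r b d = r \<bullet> u"
  unfolding lp_value_def lp_optimal_iff by (intro cSup_eq_maximum) auto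

lemma inner_mono_vec:
  fixes r x y :: "real ^ 'n"
  assumes "0 \<le> r" "x \<le> y"
  shows "r \<bullet> x \<le> r \<bullet> y"
  using assms by (auto simp: inner_vec_def less_eq_vec_def intro!: sum_mono mult_left_mono)

lemma matrix_vector_mono:
  fixes A :: "real ^ 'n ^ 'm"
  assumes "\<forall>i j. 0 \<le> A $ i $ j" "x \<le> y"
  shows "A *v x \<le> A *v y"
  using assms by (auto simp: matrix_vector_mult_def less_eq_vec_def intro!: sum_mono mult_left_mono)

lemma lp_optimal_exists:
  assumes "0 \<le> b" "0 \<le> d"
  shows "\<exists>y. lp_optimal A r b d y"
proof -
  have eq: "lp_feasible A b d =
      (\<Inter>i. {y. (A *v y) $ i \<le> b $ i}) \<inter> (\<Inter>j. {y. 0 \<le> y $ j}) \<inter> (\<Inter>j. {y. y $ j \<le> d $ j})"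
    by (auto simp: lp_feasible_def less_eq_vec_def)
  have "closed (lp_feasible A b d)"
    unfolding eq
    by (intro closed_Int closed_INT ballI closed_Collect_le continuous_intros)
  moreover have "bounded (lp_feasible A b d)"
  proof (rule boundedI)
    fix y assume "y \<in> lp_feasible A b d"
    then have "\<bar>y $ j\<bar> \<le> d $ j" for j by (auto simp: lp_feasible_def less_eq_vec_def)
    then show "norm y \<le> (\<Sum>j\<in>UNIV. d $ j)"
      by (intro order_trans[OF norm_le_l1_cart] sum_mono)
  qed
  ultimately have "compact (lp_feasible A b d)" by (simp add: compact_eq_bounded_closed)
  moreover have "lp_feasible A b d \<noteq> {}"
    using assms by (auto simp: lp_feasible_def intro!: exI[of _ 0])
  ultimately have "\<exists>y\<in>lp_feasible A b d. \<forall>x\<in>lp_feasible A b d. r \<bullet> x \<le> r \<bullet> y"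
    by (intro continuous_attains_sup continuous_intros)
  then show ?thesis by (auto simp: lp_optimal_iff)
qed

lemma lp_optimal_zero_value:
  assumes "lp_optimal A r b 0 y"
  shows "r \<bullet> y = 0"
proof -
  have "y = 0" using assms by (auto simp: lp_optimal_iff lp_feasible_def intro: antisym)
  then show ?thesis by simp
qed

text \<open>Hoffman's bound for near-optimal sets: demanding objective value at least
  \<open>v\<close> adds the row \<open>- r\<close>. If \<open>v\<close> is the optimal value, the
  point found is an optimal solution.\<close>

lemma lp_perturbation:
  fixes A :: "real ^ 'n ^ 'm" and r :: "real ^ 'n"
  shows "\<exists>K\<ge>0. \<forall>b d v u e. (\<exists>x\<in>lp_feasible A b d. v \<le> r \<bullet> x) \<longrightarrow> 0 \<le> e \<longrightarrow>
    (\<forall>i. (A *v u) $ i \<le> b $ i + e) \<longrightarrow> (\<forall>j. - e \<le> u $ j) \<longrightarrow> (\<forall>j. u $ j \<le> d $ j + e) \<longrightarrow>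
    v - e \<le> r \<bullet> u \<longrightarrow> (\<exists>x\<in>lp_feasible A b d. v \<le> r \<bullet> x \<and> norm (u - x) \<le> K * e)"
proof -
  define a :: "('m + 'n) + ('n + unit) \<Rightarrow> real ^ 'n" where
    "a i = (case i of Inl (Inl i) \<Rightarrow> A $ i | Inl (Inr j) \<Rightarrow> - axis j 1
      | Inr (Inl j) \<Rightarrow> axis j 1 | Inr (Inr _) \<Rightarrow> - r)" for i
  obtain K where K: "K \<ge> 0"
    "\<And>\<beta> u e. {x. \<forall>i\<in>UNIV. a i \<bullet> x \<le> \<beta> i} \<noteq> {} \<Longrightarrow> 0 \<le> e \<Longrightarrow>
       (\<forall>i\<in>UNIV. a i \<bullet> u \<le> \<beta> i + e) \<Longrightarrow>
       (\<exists>x. (\<forall>i\<in>UNIV. a i \<bullet> x \<le> \<beta> i) \<and> norm (u - x) \<le> K * e)"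
    using hoffman_bound[of UNIV a] by auto
  show ?thesis
  proof (intro exI[of _ K] conjI allI impI K(1))
    fix b d v u e
    assume ex: "\<exists>x\<in>lp_feasible A b d. v \<le> r \<bullet> x" and e: "0 \<le> (e::real)"
      and u: "\<forall>i. (A *v u) $ i \<le> b $ i + e" "\<forall>j. - e \<le> u $ j" "\<forall>j. u $ j \<le> d $ j + e"
        "v - e \<le> r \<bullet> u"
    define \<beta> :: "('m + 'n) + ('n + unit) \<Rightarrow> real" where
      "\<beta> i = (case i of Inl (Inl i) \<Rightarrow> b $ i | Inl (Inr j) \<Rightarrow> 0
        | Inr (Inl j) \<Rightarrow> d $ j | Inr (Inr _) \<Rightarrow> - v)" for i
    have all: "(\<forall>i. P i) \<longleftrightarrow> (\<forall>i. P (Inl (Inl i))) \<and> (\<forall>j. P (Inl (Inr j))) \<and>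
        (\<forall>j. P (Inr (Inl j))) \<and> P (Inr (Inr ()))" for P :: "('m + 'n) + ('n + unit) \<Rightarrow> bool"
      by (metis (full_types) old.sum.exhaust old.unit.exhaust)
    have sat: "(\<forall>i. a i \<bullet> x \<le> \<beta> i + c) \<longleftrightarrow> (\<forall>i. (A *v x) $ i \<le> b $ i + c) \<and>
        (\<forall>j. - c \<le> x $ j) \<and> (\<forall>j. x $ j \<le> d $ j + c) \<and> v - c \<le> r \<bullet> x" for x c
      unfolding all[of "\<lambda>i. a i \<bullet> x \<le> \<beta> i + c"]
      by (auto simp: a_def \<beta>_def inner_axis' matrix_vector_mul_component neg_le_iff_le
          algebra_simps minus_le_iff)
    have feas: "(\<forall>i. a i \<bullet> x \<le> \<beta> i) \<longleftrightarrow> x \<in> lp_feasible A b d \<and> v \<le> r \<bullet> x" for x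
      using sat[of x 0] by (auto simp: lp_feasible_def less_eq_vec_def)
    show "\<exists>x\<in>lp_feasible A b d. v \<le> r \<bullet> x \<and> norm (u - x) \<le> K * e"
      using K(2)[of \<beta> e u] ex e u sat[of u e] by (auto simp: feas)
  qed
qed

locale packing_lp =
  fixes A :: "real ^ 'n ^ 'm" and r :: "real ^ 'n"
  assumes A_nonneg: "\<forall>i j. 0 \<le> A $ i $ j" and r_nonneg: "0 \<le> r"
begin

lemma lp_value_upper:
  assumes "y \<in> lp_feasible A b d"
  shows "r \<bullet> y \<le> lp_value A r b d"
  unfolding lp_value_def using assms inner_mono_vec[OF r_nonneg]
  by (intro cSUP_upper bdd_aboveI2[of _ _ "r \<bullet> d"]) (auto simp: lp_feasible_def)

text \<open>Adding the unit vector back turns every solution of the reduced problem into one of the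
  original problem.\<close>

lemma lp_optimal_accept:
  assumes u: "lp_optimal A r b d u" and "1 \<le> u $ j"
  shows "lp_optimal A r (b - column j A) (d - axis j 1) (u - axis j 1)"
  unfolding lp_optimal_iff
proof (intro conjI ballI)
  have "A *v (u - axis j 1) \<le> b - column j A" "u - axis j 1 \<le> d - axis j 1"
    using u by (auto simp: lp_optimal_iff lp_feasible_def matrix_vector_mult_diff_distrib
        matrix_vector_mult_basis)
  moreover have "0 \<le> u - axis j 1"
    using assms by (auto simp: lp_optimal_iff lp_feasible_def less_eq_vec_def axis_def)
  ultimately show "u - axis j 1 \<in> lp_feasible A (b - column j A) (d - axis j 1)"
    by (simp add: lp_feasible_def)
next
  fix y assume "y \<in> lp_feasible A (b - column j A) (d - axis j 1)"
  moreover have "0 \<le> (axis j 1 :: real ^ 'n)" by (simp add: less_eq_vec_def axis_def)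
  ultimately have "y + axis j 1 \<in> lp_feasible A b d"
    by (auto simp: lp_feasible_def matrix_vector_right_distrib
        matrix_vector_mult_basis le_diff_eq intro!: add_nonneg_nonneg)
  then have "r \<bullet> (y + axis j 1) \<le> r \<bullet> u" using u by (auto simp: lp_optimal_iff)
  then show "r \<bullet> y \<le> r \<bullet> (u - axis j 1)" by (simp add: inner_simps)
qed

text \<open>The reduced demand still admits \<open>u\<close> and only shrinks the feasible
  set.\<close>

lemma lp_optimal_reject:
  assumes u: "lp_optimal A r b d u" and "u $ j \<le> d $ j - 1"
  shows "lp_optimal A r b (d - axis j 1) u"
  unfolding lp_optimal_iff
proof (intro conjI ballI)
  show "u \<in> lp_feasible A b (d - axis j 1)"
    using assms by (auto simp: lp_optimal_iff lp_feasible_def less_eq_vec_def axis_def)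
next
  fix y assume "y \<in> lp_feasible A b (d - axis j 1)"
  moreover have "axis j 1 \<ge> (0 :: real ^ 'n)" by (simp add: less_eq_vec_def axis_def)
  ultimately have "y \<in> lp_feasible A b d"
    by (auto simp: lp_feasible_def le_diff_eq intro: order_trans[rotated])
  then show "r \<bullet> y \<le> r \<bullet> u" using u by (auto simp: lp_optimal_iff)
qed

text \<open>Truncating an optimal solution for \<open>d'\<close> at \<open>d\<close> keeps it
  feasible, since \<open>A\<close> is nonnegative, and lowers every component by at most
  \<open>e\<close>.\<close>

lemma lp_value_demand_lipschitz:
  assumes "0 \<le> b" "0 \<le> d" "0 \<le> d'" and e: "\<And>j. d' $ j \<le> d $ j + e" "0 \<le> e"
  shows "lp_value A r b d' - (\<Sum>j\<in>UNIV. r $ j) * e \<le> lp_value A r b d"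
proof -
  obtain y where y: "lp_optimal A r b d' y" using lp_optimal_exists assms by blast
  define y' where "y' = (\<chi> j. min (y $ j) (d $ j))"
  have y'y: "y' \<le> y" by (simp add: y'_def less_eq_vec_def)
  have "A *v y' \<le> b"
    using matrix_vector_mono[OF A_nonneg y'y] y by (auto simp: lp_optimal_iff lp_feasible_def)
  then have "y' \<in> lp_feasible A b d"
    using y assms(2) by (auto simp: lp_optimal_iff lp_feasible_def y'_def less_eq_vec_def)
  then have "r \<bullet> y' \<le> lp_value A r b d" by (rule lp_value_upper)
  moreover have "y $ j - e \<le> y' $ j" for j
  proof -
    have "y $ j \<le> d' $ j" using y by (auto simp: lp_optimal_iff lp_feasible_def less_eq_vec_def)
    then show ?thesis using e(1)[of j] e(2) by (auto simp: y'_def)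
  qed
  then have "r \<bullet> (y - (\<chi> j. e)) \<le> r \<bullet> y'"
    by (intro inner_mono_vec r_nonneg) (auto simp: less_eq_vec_def)
  moreover have "r \<bullet> (\<chi> j. e) = (\<Sum>j\<in>UNIV. r $ j) * e"
    by (simp add: inner_vec_def sum_distrib_right)
  ultimately show ?thesis using lp_value_eq[OF y] by (simp add: inner_simps)
qed

text \<open>The plan \<open>u\<close> almost satisfies the system describing optimal solutions for
  \<open>d'\<close>: only demands and objective can be violated, both in proportion to
  \<open>e\<close>.\<close>

lemma lp_optimal_demand_stability:
  "\<exists>K\<ge>0. \<forall>b d d' u e. 0 \<le> b \<longrightarrow> 0 \<le> d' \<longrightarrow> lp_optimal A r b d u \<longrightarrow> 0 \<le> e \<longrightarrow>
     (\<forall>j. \<bar>d $ j - d' $ j\<bar> \<le> e) \<longrightarrow> (\<exists>y. lp_optimal A r b d' y \<and> (\<forall>j. \<bar>u $ j - y $ j\<bar> \<le> K * e))"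
proof -
  obtain K where K: "K \<ge> 0"
    "\<And>b d v u e. (\<exists>x\<in>lp_feasible A b d. v \<le> r \<bullet> x) \<Longrightarrow> 0 \<le> e \<Longrightarrow>
      (\<forall>i. (A *v u) $ i \<le> b $ i + e) \<Longrightarrow> (\<forall>j. - e \<le> u $ j) \<Longrightarrow> (\<forall>j. u $ j \<le> d $ j + e) \<Longrightarrow>
      v - e \<le> r \<bullet> u \<Longrightarrow> (\<exists>x\<in>lp_feasible A b d. v \<le> r \<bullet> x \<and> norm (u - x) \<le> K * e)"
    using lp_perturbation[of A r] by blast
  \<comment> \<open>The sum covers the loss of objective value from
    \<open>lp_value_demand_lipschitz\<close>; the extra 1 makes \<open>R * e\<close> cover the
    demand violation \<open>e\<close> as well.\<close>
  define R where "R = 1 + (\<Sum>j\<in>UNIV. r $ j)"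
  have R: "R \<ge> 1" using r_nonneg by (auto simp: R_def less_eq_vec_def intro: sum_nonneg)
  have "\<exists>y. lp_optimal A r b d' y \<and> (\<forall>j. \<bar>u $ j - y $ j\<bar> \<le> K * R * e)"
    if b: "0 \<le> b" and d': "0 \<le> d'" and u: "lp_optimal A r b d u" and e: "0 \<le> e"
      and diff: "\<forall>j. \<bar>d $ j - d' $ j\<bar> \<le> e" for b d d' u e
  proof -
    obtain y where y: "lp_optimal A r b d' y" using lp_optimal_exists b d' by blast
    have eR: "e \<le> R * e" using R e by (simp add: mult_le_cancel_right1)
    have u': "A *v u \<le> b" "0 \<le> u" "u \<le> d" using u by (auto simp: lp_optimal_iff lp_feasible_def)
    then have d: "0 \<le> d" by simp
    have d'd: "d' $ j \<le> d $ j + e" "d $ j \<le> d' $ j + e" for j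
      using diff[rule_format, of j] by auto
    have "lp_value A r b d' - (\<Sum>j\<in>UNIV. r $ j) * e \<le> lp_value A r b d"
      by (rule lp_value_demand_lipschitz[OF b d d' d'd(1) e])
    then have val: "r \<bullet> y - R * e \<le> r \<bullet> u"
      using lp_value_eq[OF y] lp_value_eq[OF u] e by (simp add: R_def algebra_simps)
    have "\<exists>x\<in>lp_feasible A b d'. r \<bullet> y \<le> r \<bullet> x \<and> norm (u - x) \<le> K * (R * e)"
    proof (rule K(2))
      show "\<exists>x\<in>lp_feasible A b d'. r \<bullet> y \<le> r \<bullet> x" using y by (auto simp: lp_optimal_iff)
      show "0 \<le> R * e" using R e by simp
      show "\<forall>i. (A *v u) $ i \<le> b $ i + R * e"
        using u' \<open>0 \<le> R * e\<close> by (auto simp: less_eq_vec_def intro: add_increasing2)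
      show "\<forall>j. - (R * e) \<le> u $ j"
        using u' \<open>0 \<le> R * e\<close> by (auto simp: less_eq_vec_def intro: order_trans[of _ 0])
      show "\<forall>j. u $ j \<le> d' $ j + R * e"
        using u' d'd(2) eR by (meson add_left_mono less_eq_vec_def order_trans)
      show "r \<bullet> y - R * e \<le> r \<bullet> u" by (rule val)
    qed
    then obtain x where x: "x \<in> lp_feasible A b d'" "r \<bullet> y \<le> r \<bullet> x" "norm (u - x) \<le> K * (R * e)"
      by blast
    then have "lp_optimal A r b d' x" using y by (auto simp: lp_optimal_iff intro: order_trans)
    moreover have "\<bar>u $ j - x $ j\<bar> \<le> K * R * e" for j
      using component_le_norm_cart[of "u - x" j] x(3) by (simp add: mult.assoc)
    ultimately show ?thesis by blast
  qed
  moreover have "0 \<le> K * R" using K(1) R by simp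
  ultimately show ?thesis by blast
qed

text \<open>One acceptance shifts the right-hand sides by bounded amounts, so some solution of the
  reduced problem lies within a bounded distance of the old optimum.\<close>

lemma lp_value_accept_bounded_loss:
  "\<exists>C\<ge>0. \<forall>b d j. column j A \<le> b \<longrightarrow> axis j 1 \<le> d \<longrightarrow>
     lp_value A r b d \<le> lp_value A r (b - column j A) (d - axis j 1) + C"
proof -
  obtain K where K: "K \<ge> 0"
    "\<And>b d v u e. (\<exists>x\<in>lp_feasible A b d. v \<le> r \<bullet> x) \<Longrightarrow> 0 \<le> e \<Longrightarrow>
      (\<forall>i. (A *v u) $ i \<le> b $ i + e) \<Longrightarrow> (\<forall>j. - e \<le> u $ j) \<Longrightarrow> (\<forall>j. u $ j \<le> d $ j + e) \<Longrightarrow>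
      v - e \<le> r \<bullet> u \<Longrightarrow> (\<exists>x\<in>lp_feasible A b d. v \<le> r \<bullet> x \<and> norm (u - x) \<le> K * e)"
    using lp_perturbation[of A r] by blast
  \<comment> \<open>Bounds the violation of every row by the old optimum: at most an entry of
    \<open>A\<close> for inventories, at most 1 for demands.\<close>
  define e where "e = 1 + (\<Sum>i\<in>UNIV. \<Sum>j\<in>UNIV. A $ i $ j)"
  have Ae: "A $ i $ j \<le> e - 1" for i j
  proof -
    have "A $ i $ j \<le> (\<Sum>j\<in>UNIV. A $ i $ j)" using A_nonneg by (intro member_le_sum) auto
    also have "\<dots> \<le> (\<Sum>i\<in>UNIV. \<Sum>j\<in>UNIV. A $ i $ j)"
      using A_nonneg by (intro member_le_sum[of i UNIV "\<lambda>i. \<Sum>j\<in>UNIV. A $ i $ j"] sum_nonneg) auto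
    finally show ?thesis by (simp add: e_def)
  qed
  have e: "1 \<le> e" using A_nonneg by (auto simp: e_def intro!: sum_nonneg)
  have "lp_value A r b d \<le> lp_value A r (b - column j A) (d - axis j 1) + norm r * (K * e)"
    if b: "column j A \<le> b" and d: "axis j 1 \<le> d" for b d j
  proof -
    have "0 \<le> column j A" using A_nonneg by (simp add: less_eq_vec_def column_def)
    moreover have "0 \<le> (axis j 1 :: real ^ 'n)" by (simp add: less_eq_vec_def axis_def)
    ultimately obtain y where y: "lp_optimal A r b d y"
      using lp_optimal_exists b d by (metis order_trans)
    then have y': "A *v y \<le> b" "0 \<le> y" "y \<le> d" by (auto simp: lp_optimal_iff lp_feasible_def)
    \<comment> \<open>With \<open>v = 0\<close> the objective row holds at every feasible point;
      only feasibility and distance matter here.\<close>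
    have "\<exists>x\<in>lp_feasible A (b - column j A) (d - axis j 1). 0 \<le> r \<bullet> x \<and> norm (y - x) \<le> K * e"
    proof (rule K(2))
      show "\<exists>x\<in>lp_feasible A (b - column j A) (d - axis j 1). 0 \<le> r \<bullet> x"
        using b d by (intro bexI[of _ 0]) (auto simp: lp_feasible_def)
      show "0 \<le> e" using e by simp
      show "\<forall>i. (A *v y) $ i \<le> (b - column j A) $ i + e"
      proof
        fix i
        have "(A *v y) $ i \<le> b $ i" using y' by (auto simp: less_eq_vec_def)
        then show "(A *v y) $ i \<le> (b - column j A) $ i + e"
          using Ae[of i j] by (simp add: column_def)
      qed
      show "\<forall>j. - e \<le> y $ j"
        using y' e by (auto simp: less_eq_vec_def intro: order_trans[of _ 0])
      show "\<forall>k. y $ k \<le> (d - axis j 1) $ k + e"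
      proof
        fix k
        have "y $ k \<le> d $ k" using y' by (auto simp: less_eq_vec_def)
        then show "y $ k \<le> (d - axis j 1) $ k + e"
          using e by (auto simp: axis_def)
      qed
      show "0 - e \<le> r \<bullet> y"
        using inner_mono_vec[OF r_nonneg y'(2)] e by simp
    qed
    then obtain x where x: "x \<in> lp_feasible A (b - column j A) (d - axis j 1)"
      "norm (y - x) \<le> K * e" by blast
    have "r \<bullet> y = r \<bullet> x + r \<bullet> (y - x)" by (simp add: inner_simps)
    also have "r \<bullet> (y - x) \<le> norm r * norm (y - x)" by (rule norm_cauchy_schwarz)
    also have "\<dots> \<le> norm r * (K * e)" using x(2) by (intro mult_left_mono) auto
    finally show ?thesis using lp_value_upper[OF x(1)] lp_value_eq[OF y] by simp
  qed
  moreover have "0 \<le> norm r * (K * e)" using K(1) e by simp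
  ultimately show ?thesis by blast
qed

end

section \<open>Hindsight loss along a sample path\<close>

text \<open>Shows that the inventory test of \<open>air_accepts\<close> never blocks a type of which
  a feasible plan holds a full unit: the plan has already reserved that column.\<close>

lemma lp_feasible_column_le:
  fixes A :: "real ^ 'n ^ 'm"
  assumes "\<forall>i j. 0 \<le> A $ i $ j" "u \<in> lp_feasible A b d" "1 \<le> u $ j"
  shows "column j A \<le> b"
proof -
  have "axis j 1 \<le> u"
    using assms(2,3) by (auto simp: lp_feasible_def less_eq_vec_def axis_def)
  then have "column j A \<le> A *v u"
    using matrix_vector_mono[OF assms(1)] by (metis matrix_vector_mult_basis)
  then show ?thesis using assms(2) by (auto simp: lp_feasible_def)
qed

definition arrival_count :: "'n::finite list \<Rightarrow> nat \<Rightarrow> real ^ 'n" where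
  "arrival_count h k = (\<Sum>i<k. axis (h ! i) 1)"

definition remaining_demand :: "nat \<Rightarrow> 'n::finite list \<Rightarrow> nat \<Rightarrow> real ^ 'n" where
  "remaining_demand T h k = (\<Sum>i\<in>{k..<T}. axis (h ! i) 1)"

text \<open>This is \<open>E\<close> for a resolve in period \<open>t = s + 1\<close>, where
  \<open>T - t + 1 = T - s\<close> and \<open>t - 1 = s\<close>. For \<open>s = 0\<close> the
  quotient is 0, as in the policy.\<close>

definition forecast_error :: "nat \<Rightarrow> 'n::finite list \<Rightarrow> nat \<Rightarrow> real ^ 'n" where
  "forecast_error T h s =
     ((real T - real s) / real s) *\<^sub>R arrival_count h s - remaining_demand T h s"

lemma remaining_demand_step:
  "k < T \<Longrightarrow> remaining_demand T h k = axis (h ! k) 1 + remaining_demand T h (Suc k)"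
  by (simp add: remaining_demand_def sum.atLeast_Suc_lessThan)

lemma remaining_demand_nonneg: "0 \<le> remaining_demand T h k"
  by (auto simp: remaining_demand_def less_eq_vec_def axis_def intro!: sum_nonneg)

lemma remaining_demand_T [simp]: "remaining_demand T h T = 0"
  by (simp add: remaining_demand_def)

text \<open>Below, \<open>s\<close> and \<open>k\<close> count completed periods: the plan used in period \<open>k + 1\<close> was computed in
  period \<open>s + 1\<close>.\<close>

definition last_resolve :: "nat set \<Rightarrow> nat \<Rightarrow> nat \<Rightarrow> bool" where
  "last_resolve \<T> s k \<longleftrightarrow> s \<le> k \<and> Suc s \<in> \<T> \<and> (\<forall>i\<in>{s<..k}. Suc i \<notin> \<T>)"

text \<open>For suitable \<open>\<kappa>\<close> a sufficient condition for a lossless period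
  \<open>k + 1\<close>. The bound \<open>e\<close> is left free so that a concentration threshold
  can be inserted later; the 1 in \<open>1 + e\<close> absorbs the additive constants of the
  acceptance rule.\<close>

definition reliable :: "nat set \<Rightarrow> real \<Rightarrow> nat \<Rightarrow> 'n::finite list \<Rightarrow> nat \<Rightarrow> bool" where
  "reliable \<T> \<kappa> T h k \<longleftrightarrow> (\<exists>s e. last_resolve \<T> s k \<and> 0 \<le> e \<and>
     (\<forall>j. \<bar>forecast_error T h s $ j\<bar> \<le> e) \<and> (\<forall>j. \<kappa> * (1 + e) \<le> remaining_demand T h k $ j))"

section \<open>State of the policy along a history\<close>

lemma inventory_air_resolve [simp]: "inventory (air_resolve sel T \<T> h s) = inventory s"
  by (simp add: air_resolve_def Let_def)

lemma arrivals_air_resolve [simp]: "arrivals (air_resolve sel T \<T> h s) = arrivals s"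
  by (simp add: air_resolve_def Let_def)

lemma air_resolve_idle: "Suc (length h) \<notin> \<T> \<Longrightarrow> air_resolve sel T \<T> h s = s"
  by (simp add: air_resolve_def Let_def)

lemma air_state_at_take:
  "\<lbrakk>k \<le> n; n \<le> length h\<rbrakk> \<Longrightarrow>
     air_state_at A \<rho> sel T \<T> (take n h) k = air_state_at A \<rho> sel T \<T> h k"
  by (induction k) (auto simp: min_def)

lemma arrivals_air_state_at: "arrivals (air_state_at A \<rho> sel T \<T> h k) = arrival_count h k"
  by (induction k) (auto simp: air_update_def arrival_count_def)

lemma inventory_air_state_at_nonneg:
  "0 \<le> \<rho> \<Longrightarrow> 0 \<le> inventory (air_state_at A \<rho> sel T \<T> h k)"
  by (induction k) (auto simp: air_update_def air_accepts_def scaleR_nonneg_nonneg)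

text \<open>Each decision replays the policy on a prefix of \<open>h\<close>. The state after
  \<open>k\<close> periods reads only the first \<open>k\<close> entries, so all replays agree with
  a single run along \<open>h\<close>.\<close>

lemma reward_air_policy:
  "reward r (air_policy A \<rho> sel T \<T>) h = (\<Sum>k<length h.
     if air_accepts A (air_resolve sel T \<T> (take k h) (air_state_at A \<rho> sel T \<T> h k)) (h ! k)
     then r $ (h ! k) else 0)"
  unfolding reward_def
proof (intro sum.cong refl)
  fix k assume k: "k \<in> {..<length h}"
  then have "length (take (Suc k) h) - 1 = k" "take k (take (Suc k) h) = take k h"
    "take (Suc k) h ! k = h ! k" by (auto simp: min_def)
  then show "(if air_policy A \<rho> sel T \<T> (take (Suc k) h) then r $ (h ! k) else 0) =
      (if air_accepts A (air_resolve sel T \<T> (take k h) (air_state_at A \<rho> sel T \<T> h k)) (h ! k)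
       then r $ (h ! k) else 0)"
    using k by (simp add: air_policy_def Let_def air_state_at_take)
qed

section \<open>Per-period loss on a fixed history\<close>

locale air_run = packing_lp A r for A :: "real ^ 'n ^ 'm" and r :: "real ^ 'n" +
  fixes \<rho> :: "real ^ 'm" and sel :: "'n list \<Rightarrow> real ^ 'm \<Rightarrow> real ^ 'n \<Rightarrow> real ^ 'n"
    and T :: nat and \<T> :: "nat set" and h :: "'n list"
  assumes \<rho>_nonneg: "0 \<le> \<rho>" and sel: "lp_selector A r sel" and length_h: "length h = T"
begin

abbreviation state :: "nat \<Rightarrow> ('m, 'n) air_state" where
  "state k \<equiv> air_state_at A \<rho> sel T \<T> h k"

abbreviation resolved :: "nat \<Rightarrow> ('m, 'n) air_state" where
  "resolved k \<equiv> air_resolve sel T \<T> (take k h) (state k)"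

text \<open>Forecast and true remaining demand both drop by the unit vector of each arrival, so
  their difference is frozen until the next resolve.\<close>

lemma demand_resolved:
  assumes "last_resolve \<T> s k" "k < T"
  shows "demand (resolved k) = remaining_demand T h k + forecast_error T h s"
proof -
  have "s \<le> k" using assms by (simp add: last_resolve_def)
  then show ?thesis using assms
  proof (induction k rule: dec_induct)
    case base
    then have "demand (resolved s) = ((real T - real s) / real s) *\<^sub>R arrival_count h s"
      using length_h
      by (auto simp: air_resolve_def Let_def last_resolve_def arrivals_air_state_at vec_eq_iff min_def)
    then show ?case by (simp add: forecast_error_def)
  next
    case (step k)
    then have "last_resolve \<T> s k" "Suc (Suc k) \<notin> \<T>"
      by (auto simp: last_resolve_def)
    moreover have "resolved (Suc k) = state (Suc k)"
      using calculation(2) step.prems length_h by (intro air_resolve_idle) (simp add: min_def)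
    ultimately show ?case
      using step.IH step.prems by (simp add: air_update_def remaining_demand_step)
  qed
qed

text \<open>Acceptance and rejection each preserve optimality. Demands only decrease between
  resolves, so the bound at \<open>k\<close> holds back to \<open>s\<close>, where it also gives the
  nonnegative demand that \<open>lp_selector\<close> requires.\<close>

lemma plan_optimal:
  assumes "last_resolve \<T> s k" "k < T" "\<forall>j. 2 \<le> demand (resolved k) $ j"
  shows "lp_optimal A r (inventory (resolved k)) (demand (resolved k)) (plan (resolved k))"
proof -
  have "s \<le> k" using assms by (simp add: last_resolve_def)
  then show ?thesis using assms
  proof (induction k rule: dec_induct)
    case base
    then have "Suc s \<in> \<T>" "length (take s h) = s"
      using length_h by (auto simp: last_resolve_def)
    moreover have "0 \<le> demand (resolved s)"
      using base.prems(3) by (auto simp: less_eq_vec_def intro: order_trans[of 0 2])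
    moreover have "0 \<le> inventory (state s)"
      by (rule inventory_air_state_at_nonneg[OF \<rho>_nonneg])
    ultimately show ?case
      using sel by (simp add: air_resolve_def Let_def lp_selector_def)
  next
    case (step k)
    let ?s = "resolved k" and ?j = "h ! k"
    have *: "last_resolve \<T> s k" "Suc (Suc k) \<notin> \<T>" "k < T"
      using step by (auto simp: last_resolve_def)
    have next_eq: "resolved (Suc k) = state (Suc k)"
      using *(2) step.prems length_h by (intro air_resolve_idle) (simp add: min_def)
    then have dem: "demand ?s $ j = demand (resolved (Suc k)) $ j + axis ?j 1 $ j" for j
      by (simp add: air_update_def)
    have "2 \<le> demand ?s $ j" for j
      using step.prems(3)[rule_format, of j] dem[of j] by (auto simp: axis_def split: if_splits)
    then have opt: "lp_optimal A r (inventory ?s) (demand ?s) (plan ?s)"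
      by (intro step.IH *) auto
    show ?case
    proof (cases "air_accepts A ?s ?j")
      case True
      then have "1 \<le> plan ?s $ ?j" by (simp add: air_accepts_def)
      from lp_optimal_accept[OF opt this] show ?thesis
        unfolding next_eq using True by (simp add: air_update_def)
    next
      case False
      \<comment> \<open>Before this arrival the demand was one unit larger. A planned majority would
        therefore exceed 1 and have inventory, so the rejection means a planned minority.\<close>
      have d3: "3 \<le> demand ?s $ ?j"
        using step.prems(3)[rule_format, of ?j] dem[of ?j] by simp
      have "plan ?s $ ?j < demand ?s $ ?j - plan ?s $ ?j"
      proof (rule ccontr)
        assume "\<not> ?thesis"
        then have ge: "1 < plan ?s $ ?j" "demand ?s $ ?j - plan ?s $ ?j \<le> plan ?s $ ?j"
          using d3 by auto
        then have "column ?j A \<le> inventory ?s"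
          using opt by (intro lp_feasible_column_le[OF A_nonneg]) (auto simp: lp_optimal_iff)
        then show False using False ge by (simp add: air_accepts_def)
      qed
      then have "plan ?s $ ?j \<le> demand ?s $ ?j - 1" using d3 by linarith
      from lp_optimal_reject[OF opt this] show ?thesis
        unfolding next_eq using False by (simp add: air_update_def)
    qed
  qed
qed

definition step_reward :: "nat \<Rightarrow> real" where
  "step_reward k = (if air_accepts A (resolved k) (h ! k) then r $ (h ! k) else 0)"

text \<open>The demand forecast exceeds the true remaining demand by the constant \<open>forecast_error\<close>. If all
  remaining demands dominate this error, an optimal solution for the true demands is so close to the
  current plan that the majority rule of the policy agrees with it.\<close>

lemma reliable_step:
  assumes K: "0 \<le> K"
    "\<And>b d d' u e. \<lbrakk>0 \<le> b; 0 \<le> d'; lp_optimal A r b d u; 0 \<le> e; \<forall>j. \<bar>d $ j - d' $ j\<bar> \<le> e\<rbrakk> \<Longrightarrow>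
      \<exists>y. lp_optimal A r b d' y \<and> (\<forall>j. \<bar>u $ j - y $ j\<bar> \<le> K * e)"
    and rel: "reliable \<T> (2 * K + 6) T h k" and k: "k < T"
  shows "lp_value A r (inventory (state k)) (remaining_demand T h k)
    \<le> step_reward k + lp_value A r (inventory (state (Suc k))) (remaining_demand T h (Suc k))"
proof -
  let ?s = "resolved k" and ?j = "h ! k" and ?D = "remaining_demand T h k"
  obtain s e where s: "last_resolve \<T> s k" and e: "0 \<le> e"
    and err: "\<And>j. \<bar>forecast_error T h s $ j\<bar> \<le> e"
    and D: "\<And>j. (2 * K + 6) * (1 + e) \<le> ?D $ j"
    using rel by (auto simp: reliable_def)
  have dD: "demand ?s $ j = ?D $ j + forecast_error T h s $ j" for j
    using demand_resolved[OF s k] by simp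
  have Ke: "0 \<le> K * e" using K(1) e by simp
  have D': "2 * K + 2 * (K * e) + 6 + 6 * e \<le> ?D $ j" for j
    using D[of j] by (simp add: algebra_simps)
  \<comment> \<open>Half of this bound exceeds \<open>K * e + 1\<close> and
    \<open>K * e + e + 1\<close>, the slacks needed to pass from the plan to \<open>y\<close> when
    accepting and when rejecting.\<close>
  have d_ge: "2 * K + 2 * (K * e) + 6 + 5 * e \<le> demand ?s $ j" for j
    using D'[of j] err[of j] dD[of j] by linarith
  have "2 \<le> demand ?s $ j" for j using d_ge[of j] K(1) Ke e by linarith
  then have opt: "lp_optimal A r (inventory ?s) (demand ?s) (plan ?s)"
    by (intro plan_optimal[OF s k]) auto
  then have "\<exists>y. lp_optimal A r (inventory ?s) ?D y \<and> (\<forall>j. \<bar>plan ?s $ j - y $ j\<bar> \<le> K * e)"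
    using inventory_air_state_at_nonneg[OF \<rho>_nonneg] err dD
    by (intro K(2)[OF _ _ _ e]) (auto simp: remaining_demand_nonneg)
  then obtain y where y: "lp_optimal A r (inventory ?s) ?D y"
    and close: "\<And>j. \<bar>plan ?s $ j - y $ j\<bar> \<le> K * e" by blast
  show ?thesis
  proof (cases "air_accepts A ?s ?j")
    case True
    then have "1 \<le> y $ ?j"
      using close[of ?j] d_ge[of ?j] K(1) Ke e unfolding air_accepts_def by linarith
    from lp_value_eq[OF lp_optimal_accept[OF y this]] show ?thesis
      using True lp_value_eq[OF y] k
      by (simp add: step_reward_def air_update_def remaining_demand_step inner_diff_right inner_axis)
  next
    case False
    have "plan ?s $ ?j < demand ?s $ ?j - plan ?s $ ?j"
    proof (rule ccontr)
      assume "\<not> ?thesis"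
      then have ge: "1 < plan ?s $ ?j" "demand ?s $ ?j - plan ?s $ ?j \<le> plan ?s $ ?j"
        using d_ge[of ?j] K(1) Ke e by linarith+
      then have "column ?j A \<le> inventory ?s"
        using opt by (intro lp_feasible_column_le[OF A_nonneg]) (auto simp: lp_optimal_iff)
      then show False using False ge by (simp add: air_accepts_def)
    qed
    then have "y $ ?j \<le> ?D $ ?j - 1"
      using close[of ?j] d_ge[of ?j] dD[of ?j] err[of ?j] K(1) Ke e by linarith
    from lp_value_eq[OF lp_optimal_reject[OF y this]] show ?thesis
      using False lp_value_eq[OF y] k
      by (simp add: step_reward_def air_update_def remaining_demand_step)
  qed
qed

text \<open>An acceptance loses at most \<open>C\<close>. A rejection removes one unit of demand,
  which is worth at most the sum of all rewards.\<close>

lemma unreliable_step: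
  assumes C: "0 \<le> C" "\<And>b d j. \<lbrakk>column j A \<le> b; axis j 1 \<le> d\<rbrakk> \<Longrightarrow>
      lp_value A r b d \<le> lp_value A r (b - column j A) (d - axis j 1) + C"
    and k: "k < T"
  shows "lp_value A r (inventory (state k)) (remaining_demand T h k)
    \<le> step_reward k + (C + (\<Sum>j\<in>UNIV. r $ j))
      + lp_value A r (inventory (state (Suc k))) (remaining_demand T h (Suc k))"
proof -
  let ?s = "resolved k" and ?j = "h ! k" and ?D = "remaining_demand T h k"
    and ?D' = "remaining_demand T h (Suc k)"
  have step: "?D = axis ?j 1 + ?D'" using k by (rule remaining_demand_step)
  have r: "0 \<le> r $ j" for j using r_nonneg by (simp add: less_eq_vec_def)
  have sum_r: "0 \<le> (\<Sum>j\<in>UNIV. r $ j)" using r by (simp add: sum_nonneg)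
  show ?thesis
  proof (cases "air_accepts A ?s ?j")
    case True
    have "lp_value A r (inventory ?s) ?D
      \<le> lp_value A r (inventory ?s - column ?j A) (?D - axis ?j 1) + C"
      using True by (intro C(2)) (auto simp: air_accepts_def step remaining_demand_nonneg)
    then show ?thesis using True sum_r r[of ?j]
      by (simp add: step_reward_def air_update_def step)
  next
    case False
    have "?D $ j \<le> ?D' $ j + 1" for j by (simp add: step axis_def)
    then have "lp_value A r (inventory ?s) ?D - (\<Sum>j\<in>UNIV. r $ j) * 1
        \<le> lp_value A r (inventory ?s) ?D'"
      by (intro lp_value_demand_lipschitz)
        (auto simp: remaining_demand_nonneg inventory_air_state_at_nonneg \<rho>_nonneg)
    then show ?thesis using False C(1)
      by (simp add: step_reward_def air_update_def)
  qed
qed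

end

section \<open>Summing over the horizon\<close>

context packing_lp
begin

text \<open>The hindsight value telescopes along the run and ends at 0, when no demand remains. Both
  constants come from \<open>A\<close> and \<open>r\<close> alone, hence are uniform in horizon,
  selector, resolving set and history.\<close>

lemma hindsight_loss_bound:
  "\<exists>\<kappa>>0. \<exists>C\<ge>0. \<forall>\<rho> sel T \<T> h. 0 \<le> \<rho> \<longrightarrow> lp_selector A r sel \<longrightarrow> length h = T \<longrightarrow>
     lp_value A r (real T *\<^sub>R \<rho>) (remaining_demand T h 0)
       \<le> reward r (air_policy A \<rho> sel T \<T>) h + C * (\<Sum>k<T. of_bool (\<not> reliable \<T> \<kappa> T h k))"
proof -
  obtain K where K: "0 \<le> K"
    "\<And>b d d' u e. \<lbrakk>0 \<le> b; 0 \<le> d'; lp_optimal A r b d u; 0 \<le> e; \<forall>j. \<bar>d $ j - d' $ j\<bar> \<le> e\<rbrakk> \<Longrightarrow>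
      \<exists>y. lp_optimal A r b d' y \<and> (\<forall>j. \<bar>u $ j - y $ j\<bar> \<le> K * e)"
    using lp_optimal_demand_stability by blast
  obtain C where C: "0 \<le> C" "\<And>b d j. \<lbrakk>column j A \<le> b; axis j 1 \<le> d\<rbrakk> \<Longrightarrow>
      lp_value A r b d \<le> lp_value A r (b - column j A) (d - axis j 1) + C"
    using lp_value_accept_bounded_loss by blast
  define C' where "C' = C + (\<Sum>j\<in>UNIV. r $ j)"
  have C': "0 \<le> C'"
    using C(1) r_nonneg
    by (auto simp: C'_def less_eq_vec_def intro!: add_nonneg_nonneg sum_nonneg)
  have "lp_value A r (real T *\<^sub>R \<rho>) (remaining_demand T h 0)
      \<le> reward r (air_policy A \<rho> sel T \<T>) h
        + C' * (\<Sum>k<T. of_bool (\<not> reliable \<T> (2 * K + 6) T h k))"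
    if "0 \<le> \<rho>" "lp_selector A r sel" "length h = T" for \<rho> sel T \<T> and h :: "'n list"
  proof -
    interpret air_run A r \<rho> sel T \<T> h
      by unfold_locales (use that in auto)
    define loss where "loss k = C' * of_bool (\<not> reliable \<T> (2 * K + 6) T h k)" for k
    have step: "lp_value A r (inventory (state k)) (remaining_demand T h k)
        \<le> step_reward k + loss k
          + lp_value A r (inventory (state (Suc k))) (remaining_demand T h (Suc k))" if "k < T" for k
      using reliable_step[OF K _ that] unreliable_step[OF C that]
      by (cases "reliable \<T> (2 * K + 6) T h k") (auto simp: loss_def C'_def)
    have "lp_value A r (inventory (state 0)) (remaining_demand T h 0)
        \<le> (\<Sum>i<k. step_reward i + loss i)
          + lp_value A r (inventory (state k)) (remaining_demand T h k)" if "k \<le> T" for k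
      using that
    proof (induction k)
      case (Suc k)
      then show ?case using step[of k] by simp
    qed simp
    from this[of T] have "lp_value A r (real T *\<^sub>R \<rho>) (remaining_demand T h 0)
        \<le> (\<Sum>i<T. step_reward i + loss i) + lp_value A r (inventory (state T)) 0"
      by simp
    also have "lp_value A r (inventory (state T)) 0 = 0"
    proof -
      obtain y where "lp_optimal A r (inventory (state T)) 0 y"
        using lp_optimal_exists inventory_air_state_at_nonneg[OF \<rho>_nonneg] by blast
      then show ?thesis using lp_value_eq lp_optimal_zero_value by metis
    qed
    also have "(\<Sum>i<T. step_reward i + loss i) = reward r (air_policy A \<rho> sel T \<T>) h
        + C' * (\<Sum>k<T. of_bool (\<not> reliable \<T> (2 * K + 6) T h k))"
      by (simp add: reward_air_policy step_reward_def loss_def sum.distrib sum_distrib_left length_h)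
    finally show ?thesis by simp
  qed
  moreover have "0 < 2 * K + 6" using K(1) by simp
  ultimately show ?thesis using C' by blast
qed

text \<open>The vector counting acceptances by type is feasible for the hindsight problem.\<close>

lemma reward_le_hindsight:
  assumes "feasible_policy A \<rho> T \<pi>" "length h = T"
  shows "reward r \<pi> h \<le> lp_value A r (real T *\<^sub>R \<rho>) (remaining_demand T h 0)"
proof -
  define y where "y = (\<Sum>k<T. if \<pi> (take (Suc k) h) then axis (h ! k) 1 else (0 :: real ^ 'n))"
  have A: "A *v y = consumption A \<pi> h"
    unfolding y_def consumption_def assms(2) linear_sum[OF matrix_vector_mul_linear]
    by (intro sum.cong) (auto simp: matrix_vector_mult_basis)
  have "r \<bullet> y = reward r \<pi> h"
    unfolding y_def reward_def assms(2) inner_sum_right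
    by (intro sum.cong) (auto simp: inner_axis)
  moreover have "0 \<le> y"
    by (auto simp: y_def less_eq_vec_def axis_def intro!: sum_nonneg)
  moreover have "y \<le> remaining_demand T h 0"
    by (auto simp: y_def remaining_demand_def less_eq_vec_def axis_def lessThan_atLeast0
        intro!: sum_mono)
  moreover have "A *v y \<le> real T *\<^sub>R \<rho>"
    using assms unfolding A feasible_policy_def by simp
  ultimately show ?thesis using lp_value_upper[of y] by (simp add: lp_feasible_def)
qed

end

section \<open>Concentration of weighted counts\<close>

text \<open>Independence of the entries of a random list, by splitting off the first one.\<close>

lemma nn_integral_replicate_pmf_prod:
  fixes f :: "nat \<Rightarrow> 'a \<Rightarrow> ennreal"
  shows "(\<integral>\<^sup>+h. (\<Prod>i<n. f i (h ! i)) \<partial>replicate_pmf n p) = (\<Prod>i<n. \<integral>\<^sup>+x. f i x \<partial>p)"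
proof (induction n arbitrary: f)
  case (Suc n)
  have "(\<integral>\<^sup>+h. (\<Prod>i<Suc n. f i (h ! i)) \<partial>replicate_pmf (Suc n) p)
      = (\<integral>\<^sup>+x. \<integral>\<^sup>+h. f 0 x * (\<Prod>i<n. f (Suc i) (h ! i)) \<partial>replicate_pmf n p \<partial>p)"
    by (simp add: prod.lessThan_Suc_shift del: prod.lessThan_Suc)
  also have "\<dots> = (\<integral>\<^sup>+x. f 0 x * (\<Prod>i<n. \<integral>\<^sup>+x. f (Suc i) x \<partial>p) \<partial>p)"
    by (simp add: nn_integral_cmult Suc.IH[of "\<lambda>i. f (Suc i)"])
  also have "\<dots> = (\<Prod>i<Suc n. \<integral>\<^sup>+x. f i x \<partial>p)"
    by (simp add: nn_integral_multc prod.lessThan_Suc_shift del: prod.lessThan_Suc)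
  finally show ?case .
qed simp

text \<open>Hoeffding's lemma for a centered variable whose range has length
  \<open>\<bar>w\<bar>\<close>, whatever the sign of \<open>w\<close>.\<close>

lemma weighted_indicator_mgf:
  fixes p :: "'a pmf" and w l :: real
  assumes "0 < l"
  shows "(\<integral>\<^sup>+x. ennreal (exp (l * (w * (of_bool (x = j) - pmf p j)))) \<partial>p)
    \<le> ennreal (exp (l\<^sup>2 * w\<^sup>2 / 8))"
proof -
  define q where "q = pmf p j"
  define a where "a = min (w * (0 - q)) (w * (1 - q))"
  define b where "b = max (w * (0 - q)) (w * (1 - q))"
  have q: "0 \<le> q" "q \<le> 1" by (auto simp: q_def pmf_le_1)
  interpret interval_bounded_random_variable "measure_pmf p"
    "\<lambda>x. w * (of_bool (x = j) - q)" a b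
    by unfold_locales (auto simp: a_def b_def)
  have ex: "measure_pmf.expectation p (\<lambda>x. of_bool (x = j)) = q"
    by (subst integral_measure_pmf[of "{j}"]) (auto simp: q_def)
  have "integrable p (\<lambda>x. of_bool (x = j) :: real)"
    by (intro measure_pmf.integrable_const_bound[where B = 1]) auto
  then have "measure_pmf.expectation p (\<lambda>x. w * (of_bool (x = j) - q)) = 0"
    by (simp add: ex)
  from Hoeffdings_lemma_nn_integral_0[OF assms this]
  have "(\<integral>\<^sup>+x. ennreal (exp (l * (w * (of_bool (x = j) - q)))) \<partial>p)
    \<le> ennreal (exp (l\<^sup>2 * (b - a)\<^sup>2 / 8))" .
  also have "(b - a)\<^sup>2 = w\<^sup>2"
    by (auto simp: a_def b_def max_def min_def power2_eq_square algebra_simps)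
  finally show ?thesis by (simp add: q_def)
qed

lemma weighted_count_tail:
  fixes p :: "'a pmf" and w :: "nat \<Rightarrow> real"
  assumes x: "0 < x" and V: "(\<Sum>i<n. (w i)\<^sup>2) \<le> V" "0 < V"
  shows "measure_pmf.prob (replicate_pmf n p)
      {h. x \<le> (\<Sum>i<n. w i * (of_bool (h ! i = j) - pmf p j))} \<le> exp (- 2 * x\<^sup>2 / V)"
proof -
  \<comment> \<open>This \<open>l\<close> minimises the Chernoff exponent
    \<open>l\<^sup>2 / 8 * V - l * x\<close>.\<close>
  define l where "l = 4 * x / V"
  have l: "0 < l" using x V by (simp add: l_def)
  define S where "S h = (\<Sum>i<n. w i * (of_bool (h ! i = j) - pmf p j))" for h
  let ?P = "replicate_pmf n p"
  have "emeasure ?P {h. x \<le> S h} \<le> ennreal (exp (- l * x)) * (\<integral>\<^sup>+h. ennreal (exp (l * S h)) \<partial>?P)"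
    using Chernoff_ineq_nn_integral_ge[OF l, of UNIV ?P S x] by simp
  also have "(\<integral>\<^sup>+h. ennreal (exp (l * S h)) \<partial>?P)
      = (\<integral>\<^sup>+h. (\<Prod>i<n. ennreal (exp (l * (w i * (of_bool (h ! i = j) - pmf p j))))) \<partial>?P)"
    by (intro nn_integral_cong) (simp add: S_def sum_distrib_left exp_sum prod_ennreal)
  also have "\<dots> = (\<Prod>i<n. \<integral>\<^sup>+x. ennreal (exp (l * (w i * (of_bool (x = j) - pmf p j)))) \<partial>p)"
    by (rule nn_integral_replicate_pmf_prod)
  also have "\<dots> \<le> (\<Prod>i<n. ennreal (exp (l\<^sup>2 * (w i)\<^sup>2 / 8)))"
    by (intro prod_mono_ennreal weighted_indicator_mgf l)
  also have "\<dots> = ennreal (exp (l\<^sup>2 / 8 * (\<Sum>i<n. (w i)\<^sup>2)))"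
    by (simp add: prod_ennreal sum_distrib_left flip: exp_sum)
  also have "\<dots> \<le> ennreal (exp (l\<^sup>2 / 8 * V))"
    using V by (intro ennreal_leI) (simp add: mult_left_mono)
  also have "ennreal (exp (- l * x)) * ennreal (exp (l\<^sup>2 / 8 * V)) = ennreal (exp (- 2 * x\<^sup>2 / V))"
    using V by (simp add: l_def power2_eq_square field_simps flip: ennreal_mult exp_add)
  finally have "emeasure ?P {h. x \<le> S h} \<le> ennreal (exp (- 2 * x\<^sup>2 / V))"
    by (simp add: mult_left_mono)
  then show ?thesis by (simp add: S_def measure_pmf.emeasure_eq_measure)
qed

lemma arrival_count_component: "arrival_count h k $ j = (\<Sum>i<k. of_bool (h ! i = j))"
  unfolding arrival_count_def sum_component by (intro sum.cong) (auto simp: axis_def)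

lemma remaining_demand_component:
  "remaining_demand T h k $ j = (\<Sum>i\<in>{k..<T}. of_bool (h ! i = j))"
  unfolding remaining_demand_def sum_component by (intro sum.cong) (auto simp: axis_def)

lemma sum_lessThan_split:
  fixes f :: "nat \<Rightarrow> 'a::comm_monoid_add"
  assumes "s \<le> T"
  shows "sum f {..<T} = sum f {..<s} + sum f {s..<T}"
  using sum.atLeastLessThan_concat[of 0 s T f] assms by (simp add: lessThan_atLeast0)

definition error_weight :: "nat \<Rightarrow> nat \<Rightarrow> nat \<Rightarrow> real" where
  "error_weight T s i = (if i < s then (real T - real s) / real s else - 1)"

text \<open>The weights sum to zero, so any constant \<open>q\<close> may be subtracted;
  \<open>q = pmf p j\<close> centers the summands.\<close>

lemma forecast_error_component:
  assumes "0 < s" "s \<le> T"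
  shows "forecast_error T h s $ j = (\<Sum>i<T. error_weight T s i * (of_bool (h ! i = j) - q))"
proof -
  have "(\<Sum>i<T. error_weight T s i * (of_bool (h ! i = j) - q))
      = (\<Sum>i<s. (real T - real s) / real s * (of_bool (h ! i = j) - q))
        + (\<Sum>i\<in>{s..<T}. - 1 * (of_bool (h ! i = j) - q))"
    unfolding sum_lessThan_split[OF assms(2)]
    by (intro arg_cong2[where f = "(+)"] sum.cong) (auto simp: error_weight_def)
  also have "\<dots> = (real T - real s) / real s * ((\<Sum>i<s. of_bool (h ! i = j)) - real s * q)
        - ((\<Sum>i\<in>{s..<T}. of_bool (h ! i = j)) - (real T - real s) * q)"
    unfolding sum_distrib_left[symmetric] using assms
    by (simp add: sum_subtractf of_nat_diff del: sum_of_bool_eq)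
  also have "\<dots> = forecast_error T h s $ j"
    using assms
    by (simp add: forecast_error_def arrival_count_component remaining_demand_component field_simps
        del: sum_of_bool_eq)
  finally show ?thesis by simp
qed

lemma sum_error_weight_squared:
  assumes "0 < s" "s \<le> T"
  shows "(\<Sum>i<T. (error_weight T s i)\<^sup>2) = (real T - real s)\<^sup>2 / real s + (real T - real s)"
proof -
  have "(\<Sum>i<T. (error_weight T s i)\<^sup>2)
      = (\<Sum>i<s. ((real T - real s) / real s)\<^sup>2) + (\<Sum>i\<in>{s..<T}. 1)"
    unfolding sum_lessThan_split[OF assms(2)]
    by (intro arg_cong2[where f = "(+)"] sum.cong) (auto simp: error_weight_def)
  then show ?thesis using assms by (simp add: of_nat_diff power2_eq_square)
qed

text \<open>A union bound over three deviations for every type: forecast error upwards, forecast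
  error downwards, and remaining demand below its mean. In each case the squared weights sum to at
  most the denominator of the exponent.\<close>

lemma unreliable_prob:
  fixes p :: "'n::finite pmf"
  assumes \<kappa>: "0 < \<kappa>" and q: "0 < q" "\<And>j. q \<le> pmf p j"
    and s: "last_resolve \<T> s k" "0 < s" and k: "k < T" and long: "4 * \<kappa> / q \<le> real T - real k"
  shows "measure_pmf.prob (replicate_pmf T p) {h. \<not> reliable \<T> \<kappa> T h k}
    \<le> 3 * CARD('n) * exp (- 2 * (min (q / (4 * \<kappa>)) (q / 2) * (real T - real k))\<^sup>2
        / ((real T - real s)\<^sup>2 / real s + (real T - real s)))"
proof -
  \<comment> \<open>Off the bad events the remaining demand is at least
    \<open>q / 2 * (T - k)\<close>; the choice of \<open>x\<close> and the assumption
    \<open>long\<close> make each of \<open>\<kappa> * x\<close> and \<open>\<kappa>\<close> at most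
    half of that.\<close>
  define x where "x = min (q / (4 * \<kappa>)) (q / 2) * (real T - real k)"
  define V where "V = (real T - real s)\<^sup>2 / real s + (real T - real s)"
  have sk: "s \<le> k" "s \<le> T" using s k by (auto simp: last_resolve_def)
  have x: "0 < x" using \<kappa> q k by (simp add: x_def)
  have V: "real T - real k \<le> V" "0 < V"
  proof -
    have "real T - real s \<le> V" by (simp add: V_def)
    then show "real T - real k \<le> V" "0 < V" using sk k by auto
  qed
  let ?P = "replicate_pmf T p"
  define E where "E w j = {h. x \<le> (\<Sum>i<T. w i * (of_bool (h ! i = j) - pmf p j))}"
    for w :: "nat \<Rightarrow> real" and j
  \<comment> \<open>Its weighted sum is the expected minus the actual remaining demand.\<close>
  define w3 :: "nat \<Rightarrow> real" where "w3 i = (if i < k then 0 else - 1)" for i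
  define W where "W = {error_weight T s, \<lambda>i. - error_weight T s i, w3}"
  have tail: "measure_pmf.prob ?P (E w j) \<le> exp (- 2 * x\<^sup>2 / V)" if "w \<in> W" for w j
  proof -
    have "(\<Sum>i<T. (w3 i)\<^sup>2) = real T - real k"
      using k by (simp add: sum_lessThan_split[of k T] w3_def of_nat_diff)
    then have "(\<Sum>i<T. (w i)\<^sup>2) \<le> V"
      using that sum_error_weight_squared[OF s(2) sk(2)] V by (auto simp: W_def V_def)
    then show ?thesis
      unfolding E_def by (intro weighted_count_tail x V)
  qed
  have sub: "{h. \<not> reliable \<T> \<kappa> T h k} \<subseteq> (\<Union>w\<in>W. \<Union>j. E w j)"
  proof (rule subsetI, rule ccontr)
    fix h :: "'n list"
    assume "h \<in> {h. \<not> reliable \<T> \<kappa> T h k}" and "h \<notin> (\<Union>w\<in>W. \<Union>j. E w j)"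
    then have un: "\<not> reliable \<T> \<kappa> T h k"
      and lt: "\<And>w j. w \<in> W \<Longrightarrow> (\<Sum>i<T. w i * (of_bool (h ! i = j) - pmf p j)) < x"
      by (auto simp: E_def not_le)
    have "\<bar>forecast_error T h s $ j\<bar> \<le> x" for j
      using lt[of "error_weight T s" j] lt[of "\<lambda>i. - error_weight T s i" j]
        forecast_error_component[OF s(2) sk(2), of h j "pmf p j"]
      by (simp add: W_def sum_negf)
    moreover have "\<kappa> * (1 + x) \<le> remaining_demand T h k $ j" for j
    proof -
      have "(\<Sum>i<T. w3 i * (of_bool (h ! i = j) - pmf p j))
          = (real T - real k) * pmf p j - remaining_demand T h k $ j"
        using k
        by (simp add: sum_lessThan_split[of k T] w3_def remaining_demand_component
            sum_subtractf of_nat_diff)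
      then have "(real T - real k) * pmf p j - remaining_demand T h k $ j < x"
        using lt[of w3 j] by (simp add: W_def)
      moreover have "(real T - real k) * q \<le> (real T - real k) * pmf p j"
        using q(2) k by (intro mult_left_mono) auto
      moreover have "x \<le> q / 2 * (real T - real k)"
        unfolding x_def using k by (intro mult_right_mono) auto
      moreover have "\<kappa> * x \<le> q / 4 * (real T - real k)"
      proof -
        have "x \<le> q / (4 * \<kappa>) * (real T - real k)"
          unfolding x_def using k by (intro mult_right_mono) auto
        then have "\<kappa> * x \<le> \<kappa> * (q / (4 * \<kappa>) * (real T - real k))"
          using \<kappa> by (intro mult_left_mono) auto
        then show ?thesis using \<kappa> by simp
      qed
      moreover have "\<kappa> \<le> q / 4 * (real T - real k)"
        using long q(1) by (simp add: field_simps)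
      ultimately show ?thesis by (simp add: algebra_simps)
    qed
    ultimately have "reliable \<T> \<kappa> T h k"
      unfolding reliable_def using s(1) x by (intro exI[of _ s] exI[of _ x]) auto
    with un show False by contradiction
  qed
  have "measure_pmf.prob ?P {h. \<not> reliable \<T> \<kappa> T h k}
      \<le> measure_pmf.prob ?P (\<Union>w\<in>W. \<Union>j. E w j)"
    by (intro measure_pmf.finite_measure_mono sub) auto
  also have "\<dots> \<le> (\<Sum>w\<in>W. \<Sum>j\<in>UNIV. measure_pmf.prob ?P (E w j))"
    by (intro order_trans[OF measure_pmf.finite_measure_subadditive_finite] sum_mono
        measure_pmf.finite_measure_subadditive_finite) (auto simp: W_def)
  also have "\<dots> \<le> (\<Sum>w\<in>W. \<Sum>j\<in>(UNIV::'n set). exp (- 2 * x\<^sup>2 / V))"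
    by (intro sum_mono tail)
  also have "\<dots> = real (card W) * (CARD('n) * exp (- 2 * x\<^sup>2 / V))" by simp
  also have "\<dots> \<le> 3 * (CARD('n) * exp (- 2 * x\<^sup>2 / V))"
    by (intro mult_right_mono) (auto simp: W_def card_insert_if)
  finally show ?thesis by (simp add: x_def V_def)
qed

section \<open>Resolving periods and the exponent of the tail bound\<close>

lemma last_resolve_exists:
  assumes "Suc s0 \<in> \<T>" "s0 \<le> k"
  shows "\<exists>s\<ge>s0. last_resolve \<T> s k"
proof -
  define S where "S = {s. s \<le> k \<and> Suc s \<in> \<T>}"
  have S: "finite S" "s0 \<in> S" using assms by (auto simp: S_def)
  define s where "s = Max S"
  have "s \<in> S" unfolding s_def using S by (intro Max_in) auto
  moreover have "Suc i \<notin> \<T>" if "i \<in> {s<..k}" for i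
  proof
    assume "Suc i \<in> \<T>"
    then have "i \<le> s" unfolding s_def using that S by (intro Max_ge) (auto simp: S_def)
    then show False using that by simp
  qed
  ultimately have "last_resolve \<T> s k" by (auto simp: last_resolve_def S_def)
  moreover have "s0 \<le> s" unfolding s_def using S by (intro Max_ge)
  ultimately show ?thesis by blast
qed

text \<open>Turns each resolving period already reached into a lower bound on the sample size and an
  upper bound on the forecast horizon.\<close>

lemma last_resolve_latest:
  assumes "last_resolve \<T> s k" "\<tau> \<in> \<T>" "\<tau> \<le> Suc k"
  shows "\<tau> \<le> Suc s"
proof (cases \<tau>)
  case (Suc i)
  then show ?thesis using assms by (force simp: last_resolve_def)
qed simp

text \<open>The three upper bounds on \<open>\<delta>\<close> serve three phases: before the resolve
  near \<open>T / 2\<close>, the final stage \<open>i = M - 2\<close>, and the stages before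
  it.\<close>

lemma forecast_ratio_lower_bound:
  assumes \<beta>: "1/2 < \<beta>" "\<beta> < 1"
    and \<alpha>: "\<alpha> = (1/2 + \<epsilon>) * \<beta> ^ (M - 2)" "\<alpha> < 1"
    and \<delta>: "\<delta> \<le> \<alpha>" "\<delta> \<le> 2 * \<epsilon> * \<beta> ^ (M - 2)" "\<delta> \<le> \<beta> ^ (M - 2) * (2 * \<beta> - 1)"
    and T: "4 \<le> T" "2 \<le> real T powr \<alpha>"
    and k: "k < T" "real T powr \<alpha> \<le> real k" "real T powr \<alpha> \<le> real T - real k"
    and s: "last_resolve (resolving_set \<epsilon> \<beta> M T) s k"
  shows "0 < s" and "real T powr \<delta> / 12
    \<le> (real T - real k)\<^sup>2 / ((real T - real s)\<^sup>2 / real s + (real T - real s))"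
proof -
  let ?\<T> = "resolving_set \<epsilon> \<beta> M T"
  define a L l where "a = real T powr \<alpha>" and "L = real T - real s" and "l = real T - real k"
  define V where "V = L\<^sup>2 / real s + L"
  have sk: "s \<le> k" using s by (simp add: last_resolve_def)
  have l: "0 < l" "l \<le> L" and L: "0 < L" "L \<le> real T" using k sk by (auto simp: l_def L_def)
  have aT: "a \<le> real T" using T \<alpha> powr_mono[of \<alpha> 1 "real T"] by (simp add: a_def)
  have "nat \<lceil>a\<rceil> \<in> ?\<T>" by (simp add: a_def \<alpha>(1) resolving_set_def resolving_set_L_def)
  moreover have "nat \<lceil>a\<rceil> \<le> Suc k" using k(2) by (simp add: a_def[symmetric] nat_le_iff ceiling_le_iff)
  ultimately have "nat \<lceil>a\<rceil> \<le> Suc s" using last_resolve_latest[OF s] by blast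
  then have "a \<le> real s + 1" by (simp add: nat_le_iff ceiling_le_iff add.commute)
  then have s_ge: "a / 2 \<le> real s" using T(2) by (simp add: a_def)
  then show s_pos: "0 < s" using T(2) by (cases s) (auto simp: a_def)
  have V_pos: "0 < V" using L s_pos by (simp add: V_def add_nonneg_pos)
  have \<delta>_le: "real T powr \<delta> \<le> real T powr \<eta>" if "\<delta> \<le> \<eta>" for \<eta>
    using that T by (intro powr_mono) auto
  have "real T powr \<delta> / 12 \<le> l\<^sup>2 / V"
  proof (cases "nat \<lceil>real T / 2\<rceil> \<le> Suc k")
    case False
    then have half: "real T / 2 \<le> l" unfolding l_def by linarith
    \<comment> \<open>The 12 of the claim arises here: this factor 3 times the 4 from
      \<open>l \<ge> T / 2\<close>.\<close>
    have "V * a \<le> 3 * (real T)\<^sup>2"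
    proof -
      have "L\<^sup>2 / real s * a = L\<^sup>2 * (a / real s)" by simp
      also have "\<dots> \<le> (real T)\<^sup>2 * 2"
        using s_ge s_pos L by (intro mult_mono power_mono) (auto simp: field_simps a_def)
      finally have "L\<^sup>2 / real s * a \<le> 2 * (real T)\<^sup>2" by simp
      moreover have "L * a \<le> real T * real T" using L aT by (intro mult_mono) (auto simp: a_def)
      ultimately show ?thesis by (simp add: V_def distrib_right power2_eq_square)
    qed
    also have "\<dots> = 12 * (real T / 2)\<^sup>2" by (simp add: power2_eq_square)
    also have "\<dots> \<le> 12 * l\<^sup>2" using half by (intro mult_left_mono power_mono) auto
    finally have "a / 12 \<le> l\<^sup>2 / V" using V_pos by (simp add: field_simps)
    then show ?thesis using \<delta>_le[OF \<delta>(1)] by (simp add: a_def)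
  next
    case True
    have "nat \<lceil>real T / 2\<rceil> \<in> ?\<T>" by (simp add: resolving_set_def resolving_set_L_def)
    from last_resolve_latest[OF s this True] have "real T / 2 \<le> real s + 1" by linarith
    then have "real T / 4 \<le> real s" using T(1) by simp
    then have "L / real s \<le> 4" using L s_pos by (simp add: field_simps)
    then have "L * (L / real s) \<le> L * 4" using L by (intro mult_left_mono) auto
    then have VL: "V \<le> 5 * L" by (simp add: V_def power2_eq_square)
    \<comment> \<open>Common end of the later phases: \<open>Y\<close> is the scale of the forecast
      horizon, and the factors 5 and 2 give 10, which is below 12.\<close>
    have bound: "real T powr \<delta> / 12 \<le> l\<^sup>2 / V"
      if X: "\<delta> \<le> \<eta>" and XY: "real T powr \<eta> * Y \<le> l\<^sup>2" and Y: "L \<le> 2 * Y" for \<eta> Y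
    proof -
      have "real T powr \<delta> * V \<le> real T powr \<eta> * (10 * Y)"
        using VL Y V_pos \<delta>_le[OF X] by (intro mult_mono) auto
      also have "\<dots> \<le> 10 * l\<^sup>2" using XY by simp
      also have "\<dots> \<le> 12 * l\<^sup>2" by simp
      finally show ?thesis using V_pos by (simp add: field_simps)
    qed
    \<comment> \<open>The maximum of \<open>S\<close> is the latest stage reached. Stage 0 stands
      for none; its scale \<open>T powr (\<beta> ^ 0)\<close> is \<open>T\<close> itself.\<close>
    define S where "S = {i. i \<le> M - 2 \<and> (i = 0 \<or> nat \<lceil>real T - real T powr (\<beta> ^ i)\<rceil> \<le> Suc k)}"
    define i where "i = Max S"
    have S: "finite S" "0 \<in> S" by (auto simp: S_def)
    then have "i \<in> S" unfolding i_def by (intro Max_in) auto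
    then have i: "i \<le> M - 2" by (simp add: S_def)
    have one_le: "1 \<le> real T powr (\<beta> ^ i)" using T \<beta> by (simp add: ge_one_powr_ge_zero)
    have Li: "L \<le> 2 * real T powr (\<beta> ^ i)"
    proof (cases "i = 0")
      case True
      then show ?thesis using L T by simp
    next
      case False
      then have "nat \<lceil>real T - real T powr (\<beta> ^ i)\<rceil> \<le> Suc k"
        using \<open>i \<in> S\<close> by (simp add: S_def)
      moreover have "nat \<lceil>real T - real T powr (\<beta> ^ i)\<rceil> \<in> ?\<T>"
        using i False by (auto simp: resolving_set_def resolving_set_A_def)
      ultimately have "nat \<lceil>real T - real T powr (\<beta> ^ i)\<rceil> \<le> Suc s"
        using last_resolve_latest[OF s] by blast
      then have "real T - real T powr (\<beta> ^ i) \<le> real s + 1" by linarith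
      then show ?thesis using one_le by (simp add: L_def)
    qed
    show ?thesis
    proof (cases "i = M - 2")
      case True
      \<comment> \<open>The exponents add up to \<open>2 * \<alpha>\<close>; here the surplus
        \<open>\<epsilon>\<close> over 1/2 pays.\<close>
      have "real T powr (2 * \<epsilon> * \<beta> ^ (M - 2)) * real T powr (\<beta> ^ i) = a\<^sup>2"
        unfolding True a_def \<alpha>(1) power2_eq_square by (simp add: algebra_simps flip: powr_add)
      also have "\<dots> \<le> l\<^sup>2" using k(3) by (intro power_mono) (auto simp: a_def l_def)
      finally show ?thesis by (intro bound[OF \<delta>(2) _ Li])
    next
      case False
      \<comment> \<open>By maximality stage \<open>i + 1\<close> is still ahead, so at least its
        scale of periods remains.\<close>
      then have "Suc i \<notin> S" using Max_ge[OF S(1), of "Suc i"] by (auto simp: i_def)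
      then have "\<not> nat \<lceil>real T - real T powr (\<beta> ^ Suc i)\<rceil> \<le> Suc k"
        using i False by (auto simp: S_def)
      then have l_ge: "real T powr (\<beta> ^ Suc i) \<le> l" unfolding l_def by linarith
      have "real T powr (\<beta> ^ i * (2 * \<beta> - 1)) * real T powr (\<beta> ^ i) = (real T powr (\<beta> ^ Suc i))\<^sup>2"
        unfolding power2_eq_square by (simp add: algebra_simps flip: powr_add)
      also have "\<dots> \<le> l\<^sup>2" using l_ge by (intro power_mono) auto
      finally have "real T powr (\<beta> ^ i * (2 * \<beta> - 1)) * real T powr (\<beta> ^ i) \<le> l\<^sup>2" .
      moreover have "\<delta> \<le> \<beta> ^ i * (2 * \<beta> - 1)"
        using \<delta>(3) i \<beta> by (intro order_trans[OF \<delta>(3)] mult_right_mono power_decreasing) auto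
      ultimately show ?thesis using Li by (intro bound)
    qed
  qed
  then show "real T powr \<delta> / 12
    \<le> (real T - real k)\<^sup>2 / ((real T - real s)\<^sup>2 / real s + (real T - real s))"
    by (simp add: V_def L_def l_def)
qed

text \<open>Makes the total contribution of up to \<open>T\<close> periods with exponentially small
  failure probability a constant.\<close>

lemma bounded_times_exp_neg_powr:
  fixes c \<delta> :: real
  assumes "0 < c" "0 < \<delta>"
  shows "\<exists>B. \<forall>T::nat. real T * exp (- c * real T powr \<delta>) \<le> B"
proof -
  have "(\<lambda>T::nat. real T * exp (- c * real T powr \<delta>)) \<longlonglongrightarrow> 0"
    using assms by real_asymp
  then have "Bseq (\<lambda>T::nat. real T * exp (- c * real T powr \<delta>))"
    by (intro convergent_imp_Bseq) (auto simp: convergent_def)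
  then show ?thesis unfolding Bseq_def by (auto simp: abs_le_iff)
qed

lemma card_initial_le: "real (card {k. k < T \<and> real k < x}) \<le> real (nat \<lceil>x\<rceil>)"
proof -
  have "{k. k < T \<and> real k < x} \<subseteq> {..<nat \<lceil>x\<rceil>}" by auto linarith
  from card_mono[OF _ this] show ?thesis by simp
qed

lemma card_final_le: "real (card {k. k < T \<and> real T - real k < x}) \<le> real (nat \<lceil>x\<rceil>)"
proof -
  have "{k. k < T \<and> real T - real k < x} \<subseteq> {T - nat \<lceil>x\<rceil>..<T}" by auto linarith
  from card_mono[OF _ this] show ?thesis by simp
qed

text \<open>The first and last \<open>T powr \<alpha>\<close> periods are counted in full; the
  others together contribute a bounded amount.\<close>

lemma expected_unreliable_periods:
  fixes p :: "'n::finite pmf" and M :: nat and \<epsilon> \<beta> :: real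
  assumes p: "\<forall>j. 0 < pmf p j" and \<epsilon>: "0 < \<epsilon>" and \<beta>: "1/2 < \<beta>" "\<beta> < 1"
    and \<kappa>: "0 < \<kappa>"
  defines "\<alpha> \<equiv> (1/2 + \<epsilon>) * \<beta> ^ (M - 2)"
  shows "\<exists>C. \<forall>T\<ge>1. (\<Sum>k<T. measure_pmf.prob (replicate_pmf T p)
    {h. \<not> reliable (resolving_set \<epsilon> \<beta> M T) \<kappa> T h k}) \<le> C * real T powr \<alpha>"
proof -
  define P where "P T k = measure_pmf.prob (replicate_pmf T p)
    {h. \<not> reliable (resolving_set \<epsilon> \<beta> M T) \<kappa> T h k}" for T k
  have P1: "P T k \<le> 1" for T k by (simp add: P_def)
  have trivial: "(\<Sum>k<T. P T k) \<le> real T" for T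
    using sum_mono[of "{..<T}" "P T" "\<lambda>_. 1"] P1 by simp
  have \<alpha>_pos: "0 < \<alpha>" using \<epsilon> \<beta> by (simp add: \<alpha>_def)
  have ge1: "1 \<le> real T powr \<alpha>" if "1 \<le> T" for T
    using that \<alpha>_pos by (simp add: ge_one_powr_ge_zero)
  show ?thesis
  proof (cases "\<alpha> < 1")
    \<comment> \<open>As \<open>\<epsilon>\<close> is arbitrary, \<open>\<alpha> \<ge> 1\<close> can
      occur; the trivial bound \<open>T\<close> then suffices.\<close>
    case False
    have "(\<Sum>k<T. P T k) \<le> 1 * real T powr \<alpha>" if "1 \<le> T" for T
      using trivial[of T] powr_mono[of 1 \<alpha> "real T"] that False by simp
    then show ?thesis unfolding P_def by blast
  next
    case True
    define q where "q = Min (range (pmf p))"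
    have q: "0 < q" "\<And>j. q \<le> pmf p j" using p by (auto simp: q_def)
    define \<gamma> where "\<gamma> = min (q / (4 * \<kappa>)) (q / 2)"
    have \<gamma>: "0 < \<gamma>" using q \<kappa> by (simp add: \<gamma>_def)
    define \<delta> where "\<delta> = min \<alpha> (min (2 * \<epsilon> * \<beta> ^ (M - 2)) (\<beta> ^ (M - 2) * (2 * \<beta> - 1)))"
    have \<delta>: "0 < \<delta>" using \<alpha>_pos \<epsilon> \<beta> by (simp add: \<delta>_def)
    \<comment> \<open>This is \<open>2 * \<gamma>\<^sup>2\<close> times the 1/12 of
      \<open>forecast_ratio_lower_bound\<close>.\<close>
    define c where "c = \<gamma>\<^sup>2 / 6"
    have c: "0 < c" using \<gamma> by (simp add: c_def)
    obtain B where B: "\<And>T::nat. real T * exp (- c * real T powr \<delta>) \<le> B"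
      using bounded_times_exp_neg_powr[OF c \<delta>] by blast
    have B0: "0 \<le> B" using B[of 0] by simp
    \<comment> \<open>The 2 is required by \<open>forecast_ratio_lower_bound\<close>, the other term
      by the assumption \<open>long\<close> of \<open>unreliable_prob\<close>.\<close>
    define X where "X = max 2 (4 * \<kappa> / q)"
    have main: "P T k \<le> 3 * CARD('n) * exp (- c * real T powr \<delta>)"
      if T: "4 \<le> T" "X \<le> real T powr \<alpha>" and k: "k < T" "real T powr \<alpha> \<le> real k"
        "real T powr \<alpha> \<le> real T - real k" for T k
    proof -
      let ?\<T> = "resolving_set \<epsilon> \<beta> M T"
      have "2 \<le> real T powr \<alpha>" using T(2) by (simp add: X_def)
      then obtain s0 where s0: "nat \<lceil>real T powr \<alpha>\<rceil> = Suc s0"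
        by (cases "nat \<lceil>real T powr \<alpha>\<rceil>") auto
      have "Suc s0 \<in> ?\<T>"
        unfolding s0[symmetric] by (simp add: \<alpha>_def resolving_set_def resolving_set_L_def)
      moreover have "s0 \<le> k" using s0 k(2) by linarith
      ultimately obtain s where s: "last_resolve ?\<T> s k" using last_resolve_exists by blast
      note ratio = forecast_ratio_lower_bound[OF \<beta> \<alpha>_def[THEN meta_eq_to_obj_eq] True _ _ _
        T(1) \<open>2 \<le> real T powr \<alpha>\<close> k s, of \<delta>]
      have "0 < s" by (rule ratio(1)) (auto simp: \<delta>_def)
      have "real T powr \<delta> / 12
        \<le> (real T - real k)\<^sup>2 / ((real T - real s)\<^sup>2 / real s + (real T - real s))"
        by (rule ratio(2)) (auto simp: \<delta>_def)
      then have "2 * \<gamma>\<^sup>2 * (real T powr \<delta> / 12)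
        \<le> 2 * \<gamma>\<^sup>2 * ((real T - real k)\<^sup>2 / ((real T - real s)\<^sup>2 / real s + (real T - real s)))"
        by (intro mult_left_mono) auto
      then have "- 2 * (\<gamma> * (real T - real k))\<^sup>2 / ((real T - real s)\<^sup>2 / real s + (real T - real s))
          \<le> - c * real T powr \<delta>"
        by (simp add: c_def power_mult_distrib mult.commute)
      moreover have "4 * \<kappa> / q \<le> real T - real k" using T(2) k(3) by (simp add: X_def)
      from unreliable_prob[OF \<kappa> q s \<open>0 < s\<close> k(1) this]
      have "P T k \<le> 3 * CARD('n) * exp (- 2 * (\<gamma> * (real T - real k))\<^sup>2
          / ((real T - real s)\<^sup>2 / real s + (real T - real s)))"
        by (simp add: P_def \<gamma>_def)
      ultimately show ?thesis by (meson exp_le_cancel_iff mult_left_mono of_nat_0_le_iff order_trans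
          zero_le_mult_iff zero_le_numeral)
    qed
    \<comment> \<open>Above \<open>T0\<close> both conditions of \<open>main\<close> on
      \<open>T\<close> hold; below, the trivial bound is at most the constant
      \<open>T0\<close>.\<close>
    define T0 where "T0 = max 4 (X powr (1 / \<alpha>))"
    define C where "C = T0 + 4 + 3 * CARD('n) * B"
    have "(\<Sum>k<T. P T k) \<le> C * real T powr \<alpha>" if T1: "1 \<le> T" for T
    proof -
      have "(\<Sum>k<T. P T k) \<le> T0 \<or> (\<Sum>k<T. P T k) \<le> 4 * real T powr \<alpha> + 3 * CARD('n) * B"
      proof (cases "real T \<le> T0")
        case True
        then show ?thesis using trivial[of T] by simp
      next
        case False
        then have T4: "4 \<le> T" and "X powr (1 / \<alpha>) \<le> real T" by (auto simp: T0_def)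
        then have "(X powr (1 / \<alpha>)) powr \<alpha> \<le> real T powr \<alpha>" using \<alpha>_pos by (intro powr_mono2) auto
        then have X: "X \<le> real T powr \<alpha>" using \<alpha>_pos by (simp add: powr_powr X_def)
        define x where "x = real T powr \<alpha>"
        have x: "real (nat \<lceil>x\<rceil>) \<le> 2 * x" using ge1[OF T1] by (simp add: x_def) linarith
        define F where "F = 3 * CARD('n) * exp (- c * real T powr \<delta>)"
        have "P T k \<le> of_bool (real k < x) + of_bool (real T - real k < x) + F" if "k < T" for k
          using main[OF T4 X that] P1[of T k]
          by (cases "real k < x"; cases "real T - real k < x") (auto simp: x_def F_def
              intro: add_increasing2)
        then have "(\<Sum>k<T. P T k)
            \<le> (\<Sum>k<T. of_bool (real k < x) + of_bool (real T - real k < x) + F)"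
          by (intro sum_mono) auto
        also have "\<dots> = real (card {k. k < T \<and> real k < x})
            + real (card {k. k < T \<and> real T - real k < x}) + real T * F"
          by (simp add: sum.distrib Int_def)
        also have "\<dots> \<le> 2 * x + 2 * x + 3 * CARD('n) * B"
        proof (intro add_mono)
          show "real T * F \<le> 3 * CARD('n) * B"
            using mult_left_mono[OF B[of T], of "3 * CARD('n)"] by (simp add: F_def mult_ac)
        qed (use card_initial_le[of T x] card_final_le[of T x] x in linarith)+
        finally show ?thesis by (simp add: x_def)
      qed
      moreover have "T0 \<le> T0 * real T powr \<alpha>" "3 * CARD('n) * B \<le> 3 * CARD('n) * B * real T powr \<alpha>"
        using mult_left_mono[OF ge1[OF T1], of T0]
          mult_left_mono[OF ge1[OF T1], of "3 * CARD('n) * B"] B0 by (auto simp: T0_def)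
      moreover have "0 \<le> T0" "0 \<le> 3 * CARD('n) * B * real T powr \<alpha>" using B0 by (auto simp: T0_def)
      moreover have "0 \<le> T0 * real T powr \<alpha>" using \<open>0 \<le> T0\<close> by simp
      ultimately show ?thesis using ge1[OF T1] unfolding C_def distrib_right by linarith
    qed
    then show ?thesis unfolding P_def by blast
  qed
qed

section \<open>Regret\<close>

text \<open>Averages the pathwise bound. The expected hindsight value dominates every feasible
  policy, hence the supremum as well.\<close>

lemma (in packing_lp) regret_le_expected_unreliable:
  "\<exists>\<kappa>>0. \<exists>C\<ge>0. \<forall>\<rho> sel T \<T> p. 0 \<le> \<rho> \<longrightarrow> lp_selector A r sel \<longrightarrow>
     regret A r \<rho> p T (air_policy A \<rho> sel T \<T>)
       \<le> C * (\<Sum>k<T. measure_pmf.prob (replicate_pmf T p) {h. \<not> reliable \<T> \<kappa> T h k})"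
proof -
  obtain \<kappa> C where \<kappa>: "0 < \<kappa>" and C: "0 \<le> C" and
    bound: "\<And>\<rho> sel T \<T> h. \<lbrakk>0 \<le> \<rho>; lp_selector A r sel; length h = T\<rbrakk> \<Longrightarrow>
     lp_value A r (real T *\<^sub>R \<rho>) (remaining_demand T h 0)
       \<le> reward r (air_policy A \<rho> sel T \<T>) h + C * (\<Sum>k<T. of_bool (\<not> reliable \<T> \<kappa> T h k))"
    using hindsight_loss_bound by blast
  have "regret A r \<rho> p T (air_policy A \<rho> sel T \<T>)
       \<le> C * (\<Sum>k<T. measure_pmf.prob (replicate_pmf T p) {h. \<not> reliable \<T> \<kappa> T h k})"
    if \<rho>: "0 \<le> \<rho>" and sel: "lp_selector A r sel" for \<rho> sel T \<T> and p :: "'n pmf"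
  proof -
    let ?P = "replicate_pmf T p"
    have len: "length h = T" if "h \<in> set_pmf ?P" for h
      using that by (simp add: set_replicate_pmf)
    \<comment> \<open>There are finitely many histories of length \<open>T\<close>, so every
      function of the history is integrable.\<close>
    have "finite (set_pmf ?P)"
      by (rule finite_subset[OF _ finite_lists_length_eq[of UNIV T]]) (auto simp: set_replicate_pmf)
    then have int: "integrable ?P f" for f :: "'n list \<Rightarrow> real"
      by (rule integrable_measure_pmf_finite)
    define H where "H h = lp_value A r (real T *\<^sub>R \<rho>) (remaining_demand T h 0)" for h
    have "optimal_value A r \<rho> p T \<le> measure_pmf.expectation ?P H"
      unfolding optimal_value_def
    proof (rule cSUP_least)
      have "feasible_policy A \<rho> T (\<lambda>_. False)"
        using \<rho> by (simp add: feasible_policy_def consumption_def scaleR_nonneg_nonneg)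
      then show "{\<pi>. feasible_policy A \<rho> T \<pi>} \<noteq> {}" by blast
    next
      fix \<pi> assume "\<pi> \<in> {\<pi>. feasible_policy A \<rho> T \<pi>}"
      then show "policy_value r p T \<pi> \<le> measure_pmf.expectation ?P H"
        unfolding policy_value_def
        by (intro integral_mono_AE int AE_pmfI) (auto simp: H_def len reward_le_hindsight)
    qed
    also have "\<dots> \<le> measure_pmf.expectation ?P (\<lambda>h. reward r (air_policy A \<rho> sel T \<T>) h
        + C * (\<Sum>k<T. of_bool (\<not> reliable \<T> \<kappa> T h k)))"
      unfolding H_def by (intro integral_mono_AE int AE_pmfI bound \<rho> sel len)
    also have "\<dots> = policy_value r p T (air_policy A \<rho> sel T \<T>)
        + C * (\<Sum>k<T. measure_pmf.expectation ?P (\<lambda>h. of_bool (\<not> reliable \<T> \<kappa> T h k)))"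
      by (simp add: policy_value_def int del: sum_of_bool_eq)
    also have "(\<Sum>k<T. measure_pmf.expectation ?P (\<lambda>h. of_bool (\<not> reliable \<T> \<kappa> T h k)))
        = (\<Sum>k<T. measure_pmf.prob ?P {h. \<not> reliable \<T> \<kappa> T h k})"
    proof (intro sum.cong refl)
      fix k
      show "measure_pmf.expectation ?P (\<lambda>h. of_bool (\<not> reliable \<T> \<kappa> T h k))
        = measure_pmf.prob ?P {h. \<not> reliable \<T> \<kappa> T h k}"
        using Bochner_Integration.integral_indicator[of "measure_pmf ?P"
            "{h. \<not> reliable \<T> \<kappa> T h k}"]
        by (simp add: indicator_def[abs_def])
    qed
    finally show ?thesis by (simp add: regret_def)
  qed
  then show ?thesis using \<kappa> C by blast
qed

theorem theorem2:
  fixes A :: "real ^ 'n ^ 'm" and r :: "real ^ 'n" and \<rho> :: "real ^ 'm" and p :: "'n pmf"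
    and M :: nat and \<epsilon> \<beta> :: real
  assumes "\<forall>i j. 0 \<le> A $ i $ j" and "0 \<le> r" and "0 \<le> \<rho>" and "\<forall>j. 0 < pmf p j"
    and "2 \<le> M" and "0 < \<epsilon>" and "1/2 < \<beta>" and "\<beta> < 1"
  shows "\<exists>C. \<forall>T\<ge>1. \<forall>sel. lp_selector A r sel \<longrightarrow>
           regret A r \<rho> p T (air_policy A \<rho> sel T (resolving_set \<epsilon> \<beta> M T))
             \<le> C * real T powr ((1/2 + \<epsilon>) * \<beta> ^ (M - 2))"
proof -
  interpret packing_lp A r by unfold_locales (use assms in auto)
  obtain \<kappa> C where \<kappa>: "0 < \<kappa>" and C: "0 \<le> C"
    and regret: "\<And>\<rho> sel T \<T> p. \<lbrakk>0 \<le> \<rho>; lp_selector A r sel\<rbrakk> \<Longrightarrow>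
     regret A r \<rho> p T (air_policy A \<rho> sel T \<T>)
       \<le> C * (\<Sum>k<T. measure_pmf.prob (replicate_pmf T p) {h. \<not> reliable \<T> \<kappa> T h k})"
    using regret_le_expected_unreliable by blast
  obtain C' where C': "\<And>T. 1 \<le> T \<Longrightarrow> (\<Sum>k<T. measure_pmf.prob (replicate_pmf T p)
      {h. \<not> reliable (resolving_set \<epsilon> \<beta> M T) \<kappa> T h k})
      \<le> C' * real T powr ((1/2 + \<epsilon>) * \<beta> ^ (M - 2))"
    using expected_unreliable_periods[OF assms(4,6-8) \<kappa>] by blast
  have "regret A r \<rho> p T (air_policy A \<rho> sel T (resolving_set \<epsilon> \<beta> M T))
      \<le> C * C' * real T powr ((1/2 + \<epsilon>) * \<beta> ^ (M - 2))" if "1 \<le> T" "lp_selector A r sel" for T sel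
    using order_trans[OF regret[OF assms(3) that(2)] mult_left_mono[OF C'[OF that(1)] C]]
    by (simp add: mult.assoc)
  then show ?thesis by blast
qed

end
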